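(* There are absolute constants $c_3 \in (0,1)$ and $C_1,C_2,C_3 > 0$ such that the following holds for all sufficiently large $x_0$ and all $\eta,\delta\in(0,1)$: (a) if $d\ge1$ and $f \in \mathcal{M}_1(x_0;d)$ with $$C_1\, \rho\big(\tfrac{C_2}{\eta \delta}\big)^{-1} \leq d \leq \tfrac{C_3}{\eta \delta}\, e^{(\log x_0)^{c_3}},$$ then for every $x > x_0^{\delta}$, $$\sum_{\substack{p \leq x \\ f(p) \neq 0,1}} \frac{1}{p} \geq \log(1/\eta);$$ (b) if $f\in\mathcal{M}_1(x_0;d)$ is, in addition, a primitive Dirichlet character modulo a sufficiently large prime $q$ with $d\mid(q-1)$, and $\eta \delta \geq (\log q)^{-c}$ for some $0 < c < c_3$, then the same conclusion as in (a) holds assuming only the lower bound $d\ge C_1\rho(\tfrac{C_2}{\eta\delta})^{-1}$ (i.e. without the upper bound on $d$).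
   Context: Sums over $p$ are over primes. $\mu_d$ is the set of complex $d$-th roots of unity. $\rho:[0,\infty)\to\mathbb{R}$ is the Dickman–de Bruijn function: the unique continuous solution of $u\rho'(u)+\rho(u-1)=0$ for $u>1$ with $\rho(u)=1$ for $u\in[0,1]$. For $d\in\mathbb{N}$ and $x_0\ge1$, $\mathcal{M}(x_0;d)$ is the set of completely multiplicative functions $f:\mathbb{N}\to\mu_d\cup\{0\}$ such that for every $x\ge x_0$, $$\max_{\alpha\in\mu_d}|\{n\le x: f(n)=\alpha\}|\le \frac{100x}{d}\prod_{\substack{p\le x\\ f(p)=0}}\Big(1-\frac1p\Big).$$ $\mathcal{M}_1(x_0;d)$ is the set of $f\in\mathcal{M}(x_0;d)$ satisfying additionally $\sum_{p:\,f(p)=0}\frac1p\le 100$. *)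

theory Defs
  imports "HOL-Analysis.Analysis" "HOL-Computational_Algebra.Primes"
begin

text \<open>Dickman--de Bruijn function. The paper defines it on [0,inf); we extend by 0 on
  negative arguments so that it is uniquely determined as a function real to real.\<close>
definition dickman_rho :: "real \<Rightarrow> real" where
  "dickman_rho = (THE r. continuous_on {0..} r
      \<and> (\<forall>u\<in>{0..1}. r u = 1)
      \<and> (\<forall>u>1. \<exists>D. (r has_real_derivative D) (at u) \<and> u * D + r (u - 1) = 0)
      \<and> (\<forall>u<0. r u = 0))"

definition compl_mult_roots :: "nat \<Rightarrow> (nat \<Rightarrow> complex) \<Rightarrow> bool" where
  "compl_mult_roots d f \<longleftrightarrow>
     f 1 = 1
     \<and> (\<forall>m n. m \<ge> 1 \<longrightarrow> n \<ge> 1 \<longrightarrow> f (m * n) = f m * f n)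
     \<and> (\<forall>n. n \<ge> 1 \<longrightarrow> f n = 0 \<or> f n ^ d = 1)"

definition classM :: "real \<Rightarrow> nat \<Rightarrow> (nat \<Rightarrow> complex) set" where
  "classM x0 d = {f. compl_mult_roots d f \<and>
     (\<forall>x::real. x \<ge> x0 \<longrightarrow> (\<forall>\<alpha>::complex. \<alpha> ^ d = 1 \<longrightarrow>
        real (card {n::nat. 1 \<le> n \<and> real n \<le> x \<and> f n = \<alpha>})
          \<le> 100 * x / real d * (\<Prod>p\<in>{p::nat. prime p \<and> real p \<le> x \<and> f p = 0}. 1 - 1 / real p)))}"

text \<open>The condition sum over primes p with f p = 0 of 1/p at most 100 (a series of
  nonnegative terms) is expressed by bounding all partial sums.\<close>
definition classM1 :: "real \<Rightarrow> nat \<Rightarrow> (nat \<Rightarrow> complex) set" where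
  "classM1 x0 d = {f \<in> classM x0 d.
     \<forall>N::nat. (\<Sum>p\<in>{p::nat. prime p \<and> p \<le> N \<and> f p = 0}. 1 / real p) \<le> 100}"

definition dirichlet_char :: "nat \<Rightarrow> (nat \<Rightarrow> complex) \<Rightarrow> bool" where
  "dirichlet_char q chi \<longleftrightarrow> q \<ge> 1
     \<and> chi 1 = 1
     \<and> (\<forall>m n. chi (m * n) = chi m * chi n)
     \<and> (\<forall>n. chi (n + q) = chi n)
     \<and> (\<forall>n. chi n = 0 \<longleftrightarrow> \<not> coprime n q)"

definition primitive_dirichlet_char :: "nat \<Rightarrow> (nat \<Rightarrow> complex) \<Rightarrow> bool" where
  "primitive_dirichlet_char q chi \<longleftrightarrow> dirichlet_char q chi
     \<and> \<not> (\<exists>q'. q' dvd q \<and> q' < q \<and>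
            (\<forall>m n. coprime m q \<longrightarrow> coprime n q \<longrightarrow> m mod q' = n mod q' \<longrightarrow> chi m = chi n))"

end

theory Submission
  imports Defs "HOL-Computational_Algebra.Squarefree"
begin

text \<open>Let \<open>L = ln x0\<close> and \<open>u = 1 / (\<eta> \<delta>)\<close>. Because the counting bound for \<open>f n = 1\<close> holds at every
  \<open>x \<ge> x0\<close>, summing it dyadically gives that the sum of \<open>n powr (-1 - 1 / L)\<close> over the \<open>n \<ge> x0\<close> with
  \<open>f n = 1\<close> is \<open>O(L / d)\<close>. This logarithmic average is easy to bound from below, without any sieve.
  If the conclusion fails, the primes \<open>p \<le> y = x0 powr \<delta>\<close> with \<open>f p \<noteq> 1\<close> have reciprocal sum at most
  \<open>ln (1 / \<eta>) + 100\<close>. Put \<open>z = x0 powr (\<kappa> / u)\<close> for a small constant \<open>\<kappa>\<close>. By Mertens, the primes in \<open>(z, y]\<close> with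
  \<open>f p = 1\<close> carry mass at least 1, and the Euler product over the primes \<open>p \<le> z\<close> with \<open>f p = 1\<close> is
  \<open>\<ge> c \<eta> ln z\<close>. Multiplying \<open>k = \<lceil>u / \<kappa>\<rceil>\<close> primes of the first kind (so that the product exceeds \<open>x0\<close>) by a
  squarefree product of primes of the second kind yields a lower bound \<open>\<ge> c \<eta> ln z / k!\<close>, hence
  \<open>d \<le> C u\<^sup>2 k!\<close>. As \<open>dickman_rho v \<le> 1 / \<lfloor>v\<rfloor>!\<close>, this contradicts the lower bound on \<open>d\<close>.\<close>

subsection \<open>The Dickman function\<close>

lemma integral_has_derivative_atLeast:
  fixes g :: "real \<Rightarrow> real"
  assumes "continuous_on {a..} g" "a \<le> v"
  shows "((\<lambda>x. integral {a..x} g) has_real_derivative g v) (at v within {a..})"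
proof -
  have "((\<lambda>x. integral {a..x} g) has_real_derivative g v) (at v within {a..v+1})"
    using assms by (intro integral_has_real_derivative) (auto intro: continuous_on_subset)
  moreover have "at v within {a..v+1} = at v within {a..}"
    by (rule at_within_nhd[where S="{..<v+1}"]) auto
  ultimately show ?thesis by simp
qed

lemma integral_has_derivative_greaterThan:
  fixes g :: "real \<Rightarrow> real"
  assumes "continuous_on {a..} g" "a < v"
  shows "((\<lambda>x. integral {a..x} g) has_real_derivative g v) (at v)"
proof -
  have "at v within {a..} = at v"
    by (rule at_within_interior) (use assms in auto)
  with integral_has_derivative_atLeast[OF assms(1), of v] assms(2) show ?thesis by simp
qed

text \<open>The predicate under \<open>THE\<close> in \<open>dickman_rho\<close>, named so that its
  consequences can be derived for an arbitrary solution before existence and uniqueness transfer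
  them to \<open>dickman_rho\<close>.\<close>

definition dickman_function :: "(real \<Rightarrow> real) \<Rightarrow> bool" where
  "dickman_function r \<longleftrightarrow> continuous_on {0..} r
      \<and> (\<forall>u\<in>{0..1}. r u = 1)
      \<and> (\<forall>u>1. \<exists>D. (r has_real_derivative D) (at u) \<and> u * D + r (u - 1) = 0)
      \<and> (\<forall>u<0. r u = 0)"

text \<open>One Picard step; iterating it stabilises on each bounded interval after finitely many steps.\<close>

definition dickman_step :: "(real \<Rightarrow> real) \<Rightarrow> real \<Rightarrow> real" where
  "dickman_step r u = (if u < 0 then 0 else if u \<le> 1 then 1
     else 1 - integral {1..u} (\<lambda>t. r (t - 1) / t))"

lemma continuous_on_dickman_integrand:
  assumes "continuous_on {0..} r"
  shows "continuous_on {1..} (\<lambda>t::real. r (t - 1) / t :: real)"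
proof -
  have "continuous_on {1..} (\<lambda>t::real. r (t - 1))"
    by (rule continuous_on_compose2[OF assms, of _ "\<lambda>t. t - 1"])
      (auto intro!: continuous_on_diff continuous_on_id continuous_on_const)
  then show ?thesis by (rule continuous_on_divide) auto
qed

lemma continuous_on_dickman_step:
  assumes "continuous_on {0..} r"
  shows "continuous_on {0..} (dickman_step r)"
proof -
  let ?F = "\<lambda>x. integral {1..x} (\<lambda>t. r (t - 1) / t)"
  have "continuous_on {1..} ?F"
    using integral_has_derivative_atLeast[OF continuous_on_dickman_integrand[OF assms]]
    by (intro DERIV_continuous_on) auto
  \<comment> \<open>Clamping by \<open>max 1 u\<close> joins the two branches: for
    \<open>u \<le> 1\<close> the integral is over a point and vanishes.\<close>
  then have "continuous_on {0..} (\<lambda>u. 1 - ?F (max 1 u))"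
    by (intro continuous_on_diff continuous_on_const
        continuous_on_compose2[where g = ?F and f = "max 1"] continuous_on_max continuous_on_id) auto
  then show ?thesis
    by (rule continuous_on_eq) (auto simp: dickman_step_def max_def)
qed

lemma dickman_step_has_derivative:
  assumes "continuous_on {0..} r" "u > 1"
  shows "(dickman_step r has_real_derivative - (r (u - 1) / u)) (at u)"
proof -
  have "((\<lambda>u. 1 - integral {1..u} (\<lambda>t. r (t - 1) / t)) has_real_derivative - (r (u - 1) / u)) (at u)"
    using integral_has_derivative_greaterThan[OF continuous_on_dickman_integrand[OF assms(1)] assms(2)]
    by (auto intro!: derivative_eq_intros)
  then show ?thesis
    by (rule has_field_derivative_transform_within_open[where S = "{1<..}"])
      (use assms(2) in \<open>auto simp: dickman_step_def\<close>)
qed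

text \<open>Method of steps: the delay 1 makes each Picard iterate correct on one further unit
  interval, so the iterates are eventually constant at every point and their pointwise limit is a
  solution.\<close>

lemma dickman_function_exists: "\<exists>r. dickman_function r"
proof -
  define R where "R n = (dickman_step ^^ n) (\<lambda>u. if u < 0 then 0 else 1)" for n
  have R_Suc: "R (Suc n) = dickman_step (R n)" for n by (simp add: R_def)
  have "continuous_on {0..} (R 0)"
    unfolding R_def by (rule continuous_on_eq[where f = "\<lambda>_. 1"]) auto
  then have cont: "continuous_on {0..} (R n)" for n
    by (induction n) (auto simp: R_Suc continuous_on_dickman_step)
  \<comment> \<open>For \<open>u \<le> n + 2\<close> the integrand sees only arguments up to
    \<open>n + 1\<close>, where the two preceding iterates agree by induction.\<close>
  have step: "R (Suc n) u = R n u" if "u \<le> real n + 1" for n u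
    using that
  proof (induction n arbitrary: u)
    case 0
    then show ?case by (auto simp: R_def dickman_step_def)
  next
    case (Suc n)
    have "integral {1..u} (\<lambda>t. R (Suc n) (t - 1) / t) = integral {1..u} (\<lambda>t. R n (t - 1) / t)"
      using Suc.prems by (intro integral_cong) (simp add: Suc.IH)
    then have "dickman_step (R (Suc n)) u = dickman_step (R n) u" by (simp add: dickman_step_def)
    then show ?case by (simp only: R_Suc)
  qed
  have stable: "R (n + k) u = R n u" if "u \<le> real n" for n k u
    using that by (induction k) (auto simp: step)
  \<comment> \<open>For negative \<open>u\<close> the index is 0, and \<open>R 0\<close> already
    vanishes there.\<close>
  define r where "r u = R (nat \<lceil>u\<rceil>) u" for u
  have r_eq: "r u = R n u" if "u \<le> real n" for n u
  proof -
    have "nat \<lceil>u\<rceil> \<le> n" using that by linarith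
    then obtain k where "n = nat \<lceil>u\<rceil> + k" using le_Suc_ex by blast
    then show ?thesis unfolding r_def using stable[of u "nat \<lceil>u\<rceil>" k] by (simp add: real_nat_ceiling_ge)
  qed
  have "dickman_function r"
    unfolding dickman_function_def
  proof (intro conjI allI impI ballI)
    show "continuous_on {0..} r"
      unfolding continuous_on_eq_continuous_within
    proof
      fix u :: real assume u: "u \<in> {0..}"
      \<comment> \<open>The margin 1 ensures that \<open>r\<close> coincides with the single iterate
        \<open>R n\<close> on a whole neighbourhood of \<open>u\<close>.\<close>
      define n where "n = nat \<lceil>u + 1\<rceil>"
      have n: "u + 1 \<le> real n" unfolding n_def by (rule real_nat_ceiling_ge)
      show "continuous (at u within {0..}) r"
      proof (rule continuous_transform_within[where \<delta> = 1])
        show "continuous (at u within {0..}) (R n)"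
          using cont u by (simp add: continuous_on_eq_continuous_within)
      qed (use u n in \<open>auto simp: r_eq[of _ n] dist_real_def\<close>)
    qed
    show "r u = 1" if "u \<in> {0..1}" for u
      using that r_eq[of u 1] by (auto simp: R_def dickman_step_def)
    show "r u = 0" if "u < 0" for u
      using that r_eq[of u 1] by (auto simp: R_def dickman_step_def)
    fix u :: real assume u: "u > 1"
    define n where "n = nat \<lceil>u + 1\<rceil>"
    have n: "u + 1 \<le> real n" unfolding n_def by (rule real_nat_ceiling_ge)
    have "(R (Suc n) has_real_derivative - (R n (u - 1) / u)) (at u)"
      unfolding R_Suc by (rule dickman_step_has_derivative[OF cont u])
    then have "(r has_real_derivative - (R n (u - 1) / u)) (at u)"
      by (rule has_field_derivative_transform_within_open[where S = "{..<real n}"])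
        (use n in \<open>auto simp: r_eq[of _ "Suc n"]\<close>)
    then show "\<exists>D. (r has_real_derivative D) (at u) \<and> u * D + r (u - 1) = 0"
      using u n r_eq[of "u - 1" n] by (intro exI[of _ "- (R n (u - 1) / u)"]) auto
  qed
  then show ?thesis by blast
qed

lemma dickman_function_has_derivative:
  assumes "dickman_function r" "u > 1"
  shows "(r has_real_derivative - r (u - 1) / u) (at u)"
proof -
  obtain D where "(r has_real_derivative D) (at u)" "u * D + r (u - 1) = 0"
    using assms unfolding dickman_function_def by blast
  moreover from this(2) have "D = - r (u - 1) / u" using assms(2) by (simp add: field_simps)
  ultimately show ?thesis by simp
qed

text \<open>Agreement up to \<open>n + 1\<close> forces equal derivatives on
  \<open>(1, n + 2)\<close>, so the difference is constant from 1 onwards there, and it is 0 at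
  1.\<close>

lemma dickman_function_unique:
  assumes r: "dickman_function r" and s: "dickman_function s"
  shows "r = s"
proof -
  have "r u = s u" if "u \<le> real n + 1" for n u
    using that
  proof (induction n arbitrary: u)
    case 0
    then show ?case using r s by (cases "u < 0") (auto simp: dickman_function_def)
  next
    case (Suc n)
    show ?case
    proof (cases "u > 1")
      case False
      then show ?thesis using r s by (cases "u < 0") (auto simp: dickman_function_def)
    next
      case True
      have "(\<lambda>x. r x - s x) u = (\<lambda>x. r x - s x) 1"
      proof (rule DERIV_isconst_end[OF True])
        have "continuous_on {0..} r" "continuous_on {0..} s"
          using r s by (auto simp: dickman_function_def)
        then show "continuous_on {1..u} (\<lambda>x. r x - s x)"
          by (intro continuous_intros) (auto elim!: continuous_on_subset)
        show "((\<lambda>x. r x - s x) has_real_derivative 0) (at x)" if "1 < x" "x < u" for x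
        proof -
          have "r (x - 1) = s (x - 1)" using that Suc by auto
          then show ?thesis
            using dickman_function_has_derivative[OF r \<open>1 < x\<close>]
              dickman_function_has_derivative[OF s \<open>1 < x\<close>]
            by (auto intro!: derivative_eq_intros)
        qed
      qed
      then show ?thesis using r s by (simp add: dickman_function_def)
    qed
  qed
  moreover have "u \<le> real (nat \<lceil>u\<rceil>) + 1" for u
    using real_nat_ceiling_ge[of u] by linarith
  ultimately show ?thesis by blast
qed

lemma dickman_function_dickman_rho: "dickman_function dickman_rho"
proof -
  have "\<exists>!r. dickman_function r"
    using dickman_function_exists dickman_function_unique by blast
  then have "dickman_function (THE r. dickman_function r)" by (rule theI')
  then show ?thesis by (simp add: dickman_rho_def dickman_function_def[abs_def])
qed

section \<open>Integrated delay equation, positivity and factorial decay\<close>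

text \<open>The difference of the two sides has derivative 0 by the delay equation and vanishes at
  1. With \<open>H\<close> the primitive from 0, the identity expresses \<open>x * r x\<close> as
  the integral of \<open>r\<close> over \<open>[x - 1, x]\<close>, from which positivity and decay
  can be read off.\<close>

lemma dickman_function_average:
  assumes r: "dickman_function r"
  obtains H where "continuous_on {0..} H"
    and "\<And>x. x > 0 \<Longrightarrow> (H has_real_derivative r x) (at x)"
    and "\<And>x. x > 1 \<Longrightarrow> x * r x = H x - H (x - 1)"
proof
  have cont: "continuous_on {0..} r" and one: "\<And>u. u \<in> {0..1} \<Longrightarrow> r u = 1"
    using r by (auto simp: dickman_function_def)
  define H where "H x = integral {0..x} r" for x
  show H: "(H has_real_derivative r x) (at x)" if "x > 0" for x
    unfolding H_def using integral_has_derivative_greaterThan[OF cont that] .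
  show H_cont: "continuous_on {0..} H"
    unfolding H_def using integral_has_derivative_atLeast[OF cont]
    by (intro DERIV_continuous_on) auto
  show "x * r x = H x - H (x - 1)" if "x > 1" for x
  proof -
    let ?g = "\<lambda>x. x * r x - H x + H (x - 1)"
    have "?g x = ?g 1"
    proof (rule DERIV_isconst_end[OF that])
      have "continuous_on {1..x} r" "continuous_on {1..x} H"
        by (auto intro: continuous_on_subset[OF cont] continuous_on_subset[OF H_cont])
      moreover have "continuous_on {1..x} (\<lambda>x. H (x - 1))"
        by (rule continuous_on_compose2[OF H_cont, of _ "\<lambda>x. x - 1"])
          (auto intro!: continuous_on_diff continuous_on_id continuous_on_const)
      ultimately show "continuous_on {1..x} ?g"
        by (intro continuous_on_add continuous_on_diff continuous_on_mult continuous_on_id)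
      show "(?g has_real_derivative 0) (at y)" if "1 < y" "y < x" for y
      proof -
        have "((\<lambda>x. H (x - 1)) has_real_derivative r (y - 1)) (at y)"
          using DERIV_chain2[where f = H and g = "\<lambda>x. x - 1" and x = y and s = UNIV and Db = 1] H[of "y - 1"] that
          by (force intro!: derivative_eq_intros)
        then show ?thesis
          using that by (auto intro!: derivative_eq_intros H dickman_function_has_derivative[OF r])
      qed
    qed
    moreover have "H 1 = 1"
      unfolding H_def using integral_cong[of "{0..1}" r "\<lambda>_. 1"] one by simp
    moreover have "H 0 = 0" unfolding H_def by simp
    ultimately show ?thesis using one by simp
  qed
qed

text \<open>Just before the least point \<open>v\<close> with \<open>r v \<le> 0\<close> the
  function is positive on a whole unit interval, so the integral over \<open>[v - 1, v]\<close>,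
  which is \<open>v * r v\<close>, would be positive.\<close>

lemma dickman_function_pos:
  assumes r: "dickman_function r" and "u \<ge> 0"
  shows "r u > 0"
proof (rule ccontr)
  assume neg: "\<not> r u > 0"
  have cont: "continuous_on {0..} r" and one: "\<And>u. u \<in> {0..1} \<Longrightarrow> r u = 1"
    using r by (auto simp: dickman_function_def)
  obtain H where H_cont: "continuous_on {0..} H"
    and H: "\<And>x. x > 0 \<Longrightarrow> (H has_real_derivative r x) (at x)"
    and avg: "\<And>x. x > 1 \<Longrightarrow> x * r x = H x - H (x - 1)"
    using dickman_function_average[OF r] by blast
  have "closed {x \<in> {0..u}. r x \<le> 0}"
    by (rule continuous_on_closed_Collect_le)
      (auto intro: continuous_on_subset[OF cont] continuous_on_const)
  then have "compact {x \<in> {0..u}. r x \<le> 0}"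
    by (auto simp: compact_eq_bounded_closed intro: bounded_subset[of "{0..u}"])
  moreover have "{x \<in> {0..u}. r x \<le> 0} \<noteq> {}" using neg \<open>u \<ge> 0\<close> by auto
  ultimately have "\<exists>v\<in>{x \<in> {0..u}. r x \<le> 0}. \<forall>x\<in>{x \<in> {0..u}. r x \<le> 0}. v \<le> x"
    by (rule compact_attains_inf)
  then obtain v where v: "v \<in> {0..u}" "r v \<le> 0"
    and least: "\<And>x. x \<in> {0..u} \<Longrightarrow> r x \<le> 0 \<Longrightarrow> v \<le> x"
    by blast
  have "v > 1" using one[of v] v by (cases "v \<le> 1") auto
  have "H (v - 1) < H v"
  proof (rule DERIV_pos_imp_increasing_open[where f = H])
    show "continuous_on {v - 1..v} H"
      using \<open>v > 1\<close> by (intro continuous_on_subset[OF H_cont]) auto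
    show "\<exists>y. (H has_real_derivative y) (at x) \<and> 0 < y" if "v - 1 < x" "x < v" for x
      using H[of x] least[of x] that \<open>v > 1\<close> v
      by (intro exI[of _ "r x"]) (auto simp flip: not_le)
  qed simp
  with avg[OF \<open>v > 1\<close>] have "v * r v > 0" by simp
  with v(2) \<open>v > 1\<close> show False by (simp add: zero_less_mult_iff)
qed

text \<open>Positivity makes the derivative \<open>- r (u - 1) / u\<close> negative beyond 1; on
  \<open>[0, 1]\<close> the function is constant.\<close>

lemma dickman_function_antimono:
  assumes r: "dickman_function r" and "0 \<le> a" "a \<le> b"
  shows "r b \<le> r a"
proof -
  have one: "r u = 1" if "0 \<le> u" "u \<le> 1" for u
    using r that by (simp add: dickman_function_def)
  have anti: "r b \<le> r a" if "1 \<le> a" "a \<le> b" for a b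
  proof (cases "a = b")
    case False
    then have "a < b" using that by simp
    have "continuous_on {0..} r" using r by (simp add: dickman_function_def)
    then have "continuous_on {a..b} r"
      by (rule continuous_on_subset) (use that in auto)
    moreover have "\<exists>y. (r has_real_derivative y) (at x) \<and> y < 0" if "a < x" "x < b" for x
        using dickman_function_has_derivative[OF r, of x] dickman_function_pos[OF r, of "x - 1"]
          that \<open>1 \<le> a\<close> by (intro exI[of _ "- r (x - 1) / x"]) auto
    ultimately show ?thesis
      using DERIV_neg_imp_decreasing_open[of a b r] \<open>a < b\<close> by fastforce
  qed simp
  show ?thesis
  proof (cases "1 \<le> a")
    case False
    then show ?thesis using anti[of 1 b] one[of a] one[of b] one[of 1] assms by (cases "b \<le> 1") auto
  qed (use anti assms in simp)
qed

text \<open>By the mean value theorem the integral of \<open>r\<close> over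
  \<open>[u - 1, u]\<close> is a value of \<open>r\<close> inside that interval, which monotonicity
  bounds by the value at the left end.\<close>

lemma dickman_function_le_shift:
  assumes r: "dickman_function r" and "u \<ge> 1"
  shows "u * r u \<le> r (u - 1)"
proof (cases "u = 1")
  case True
  then show ?thesis using r by (simp add: dickman_function_def)
next
  case False
  with assms have "u > 1" by simp
  obtain H where H_cont: "continuous_on {0..} H"
    and H: "\<And>x. x > 0 \<Longrightarrow> (H has_real_derivative r x) (at x)"
    and avg: "\<And>x. x > 1 \<Longrightarrow> x * r x = H x - H (x - 1)"
    using dickman_function_average[OF r] by blast
  have "continuous_on {u - 1..u} H"
    using \<open>u > 1\<close> by (intro continuous_on_subset[OF H_cont]) auto
  moreover have "H differentiable (at x)" if "u - 1 < x" for x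
    using H[of x] that \<open>u > 1\<close> by (auto simp: real_differentiable_def)
  ultimately obtain l z where z: "u - 1 < z" "z < u" "(H has_real_derivative l) (at z)"
    "H u - H (u - 1) = (u - (u - 1)) * l"
    using MVT[of "u - 1" u H] by auto
  have "l = r z" using H[of z] z \<open>u > 1\<close> by (intro DERIV_unique[OF z(3)]) auto
  then show ?thesis
    using avg[OF \<open>u > 1\<close>] z dickman_function_antimono[OF r, of "u - 1" z] \<open>u > 1\<close> by simp
qed

text \<open>Iterating the shift inequality \<open>n\<close> times gains the factors
  \<open>n, n - 1, ..., 1\<close>, starting from \<open>r \<le> 1\<close>.\<close>

lemma dickman_function_le_inverse_fact:
  assumes r: "dickman_function r" and "u \<ge> real n"
  shows "r u \<le> 1 / fact n"
  using assms(2)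
proof (induction n arbitrary: u)
  case 0
  then show ?case using dickman_function_antimono[OF r, of 0 u] r by (simp add: dickman_function_def)
next
  case (Suc n)
  have "real (Suc n) * r u \<le> u * r u"
    using Suc.prems dickman_function_pos[OF r, of u] by (intro mult_right_mono) auto
  also have "\<dots> \<le> r (u - 1)"
    using Suc.prems by (intro dickman_function_le_shift[OF r]) simp
  also have "\<dots> \<le> 1 / fact n" using Suc.prems by (intro Suc.IH) simp
  finally show ?case by (simp add: field_simps del: of_nat_Suc)
qed

lemma fact_le_inverse_dickman_rho:
  assumes "u \<ge> real n"
  shows "fact n \<le> inverse (dickman_rho u)"
proof -
  have "dickman_rho u > 0"
    using dickman_function_pos[OF dickman_function_dickman_rho, of u] assms by simp
  with dickman_function_le_inverse_fact[OF dickman_function_dickman_rho assms]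
  show ?thesis by (simp add: field_simps)
qed

subsection \<open>Sums over primes\<close>

lemma finite_primes_le [simp]: "finite {p::nat. prime p \<and> real p \<le> t}"
proof -
  have "{p::nat. prime p \<and> real p \<le> t} \<subseteq> {..nat \<lfloor>t\<rfloor>}"
    by (auto simp: le_nat_floor)
  then show ?thesis using finite_subset by blast
qed

text \<open>Dyadic blocks: with \<open>b = 2 ^ j * a\<close>, at most \<open>2 * K * b\<close>
  elements lie in the block from \<open>b\<close> to \<open>2 * b\<close>, each of weight at most
  \<open>b powr (-1 - \<epsilon>)\<close>. The block totals are dominated by a geometric series of
  ratio \<open>2 powr (- \<epsilon>)\<close>. It serves both for all integers (Mertens) and for the
  solutions of \<open>f n = 1\<close> beyond \<open>x0\<close>.\<close>

lemma sum_powr_le_of_count_le: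
  fixes T :: "nat set" and a K \<epsilon> :: real
  assumes fin: "finite T" and "a \<ge> 1" and T: "\<And>n. n \<in> T \<Longrightarrow> a \<le> real n"
    and count: "\<And>x. x \<ge> a \<Longrightarrow> real (card {n \<in> T. real n \<le> x}) \<le> K * x"
    and "0 < \<epsilon>" "\<epsilon> \<le> 1"
  shows "(\<Sum>n\<in>T. real n powr (-1 - \<epsilon>)) \<le> 8 * K / \<epsilon>"
proof -
  have "0 \<le> K * a" using count[of a] by (meson of_nat_0_le_iff order_refl order_trans)
  then have K: "K \<ge> 0" using \<open>a \<ge> 1\<close> by (simp add: zero_le_mult_iff)
  define i where "i n = nat \<lfloor>log 2 (real n / a)\<rfloor>" for n :: nat
  define q where "q = (2::real) powr (- \<epsilon>)"
  have q: "0 < q" "q < 1" unfolding q_def using \<open>0 < \<epsilon>\<close> by (auto simp: powr_less_one)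
  have i: "2 ^ i n * a \<le> real n \<and> real n \<le> 2 ^ (i n + 1) * a" if "n \<in> T" for n
  proof -
    have ge: "real n / a \<ge> 1" using T[OF that] \<open>a \<ge> 1\<close> by simp
    then have "log 2 (real n / a) \<ge> 0" by simp
    then have "real (i n) \<le> log 2 (real n / a)" "log 2 (real n / a) \<le> real (i n + 1)"
      unfolding i_def by linarith+
    then have "2 powr real (i n) \<le> real n / a" "real n / a \<le> 2 powr real (i n + 1)"
      using ge by (simp_all add: le_log_iff log_le_iff)
    then show ?thesis using \<open>a \<ge> 1\<close> by (simp add: powr_add powr_realpow field_simps)
  qed
  have block: "(\<Sum>n\<in>{n \<in> T. i n = j}. real n powr (-1 - \<epsilon>)) \<le> 2 * K * q ^ j" for j
  proof -
    define b where "b = 2 ^ j * a"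
    have b: "b \<ge> a" "b > 0" "b \<ge> 2 ^ j" using \<open>a \<ge> 1\<close> by (auto simp: b_def mult_le_cancel_right1 mult_le_cancel_left1)
    have "(\<Sum>n\<in>{n \<in> T. i n = j}. real n powr (-1 - \<epsilon>))
        \<le> real (card {n \<in> T. i n = j}) * b powr (-1 - \<epsilon>)"
      using i b \<open>0 < \<epsilon>\<close> by (intro sum_bounded_above powr_mono2') (auto simp: b_def)
    also have "card {n \<in> T. i n = j} \<le> card {n \<in> T. real n \<le> 2 * b}"
      using i fin by (intro card_mono) (auto simp: b_def mult.assoc)
    also have "real (card {n \<in> T. real n \<le> 2 * b}) \<le> K * (2 * b)"
      using b by (intro count) simp
    also have "K * (2 * b) * b powr (-1 - \<epsilon>) = 2 * K * b powr (- \<epsilon>)"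
      using b powr_add[of b 1 "-1 - \<epsilon>"] by (simp add: field_simps)
    also have "b powr (- \<epsilon>) \<le> (2 ^ j) powr (- \<epsilon>)"
      using b \<open>0 < \<epsilon>\<close> by (intro powr_mono2') auto
    also have "(2 ^ j :: real) powr (- \<epsilon>) = q ^ j"
      by (simp add: q_def flip: powr_realpow) (simp add: powr_powr mult.commute)
    finally show ?thesis using K by (simp add: mult_left_mono mult_right_mono)
  qed
  define N where "N = Suc (Max (i ` T))"
  have "i ` T \<subseteq> {..<N}" using fin by (auto simp: N_def less_Suc_eq_le)
  then have "(\<Sum>n\<in>T. real n powr (-1 - \<epsilon>))
      = (\<Sum>j<N. \<Sum>n\<in>{n \<in> T. i n = j}. real n powr (-1 - \<epsilon>))"
    using fin by (intro sum.group[symmetric]) auto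
  also have "\<dots> \<le> (\<Sum>j<N. 2 * K * q ^ j)" by (intro sum_mono block)
  also have "\<dots> = 2 * K * ((1 - q ^ N) / (1 - q))"
    using q by (simp add: sum_gp_strict flip: sum_distrib_left)
  also have "(1 - q ^ N) / (1 - q) \<le> 1 / (1 - q)" using q by (intro divide_right_mono) auto
  \<comment> \<open>From \<open>2 powr \<epsilon> \<ge> 1 + \<epsilon> / 2\<close> and
    \<open>\<epsilon> \<le> 1\<close> one gets \<open>q \<le> 1 - \<epsilon> / 4\<close>.\<close>
  also have "1 / (1 - q) \<le> 4 / \<epsilon>"
  proof -
    have "1 + \<epsilon> / 2 \<le> 1 + \<epsilon> * ln 2"
      using ln2_ge_two_thirds \<open>0 < \<epsilon>\<close> by simp
    also have "\<dots> \<le> 2 powr \<epsilon>"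
      using exp_ge_add_one_self[of "\<epsilon> * ln 2"] by (simp add: powr_def)
    finally have "q \<le> 1 / (1 + \<epsilon> / 2)"
      using \<open>0 < \<epsilon>\<close> by (simp add: q_def powr_minus field_simps)
    also have "\<dots> \<le> 1 - \<epsilon> / 4"
      using \<open>0 < \<epsilon>\<close> \<open>\<epsilon> \<le> 1\<close> by (simp add: field_simps mult_le_cancel_left1)
    finally show ?thesis using q \<open>0 < \<epsilon>\<close> by (simp add: field_simps)
  qed
  finally show ?thesis using K by (simp add: mult_left_mono)
qed

lemma prod_prime_powers_dvd:
  fixes P :: "nat set"
  assumes "finite P" "\<And>p. p \<in> P \<Longrightarrow> prime p" "\<And>p. p \<in> P \<Longrightarrow> p ^ e p dvd m"
  shows "(\<Prod>p\<in>P. p ^ e p) dvd m"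
  using assms
proof (induction P)
  case (insert q P)
  have "coprime (q ^ e q) (\<Prod>p\<in>P. p ^ e p)"
  proof (rule prod_coprime_right)
    fix p assume "p \<in> P"
    then have "coprime q p" using insert.prems insert.hyps by (intro primes_coprime) auto
    then show "coprime (q ^ e q) (p ^ e p)" by simp
  qed
  then show ?case
    using insert by (auto intro: divides_mult)
qed simp

text \<open>Each of the factors \<open>p, 2 * p, ..., m * p\<close> of the factorial contributes one
  \<open>p\<close>.\<close>

lemma power_dvd_fact: "0 < p \<Longrightarrow> p ^ m dvd fact (p * m)" for p :: nat
proof (induction m)
  case (Suc m)
  have "p * m \<le> p * Suc m - 1" using Suc.prems by (cases p) auto
  then have "p ^ m dvd fact (p * Suc m - 1)"
    using Suc by (meson dvd_trans fact_dvd)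
  moreover have "fact (p * Suc m) = (p * Suc m) * fact (p * Suc m - 1)"
    using Suc.prems by (subst fact_reduce) auto
  ultimately show ?case by (simp add: mult_dvd_mono mult.assoc)
qed simp

text \<open>Compare \<open>n!\<close> with its divisor \<open>\<Prod>p\<le>n. p ^ (n div p)\<close>; no Chebyshev bound is needed.\<close>

lemma sum_ln_over_prime_le:
  assumes "t \<ge> 1"
  shows "(\<Sum>p\<in>{p::nat. prime p \<and> real p \<le> t}. ln (real p) / real p) \<le> 2 * ln t"
proof -
  define n where "n = nat \<lfloor>t\<rfloor>"
  define P where "P = {p::nat. prime p \<and> real p \<le> t}"
  have n: "n \<ge> 1" "real n \<le> t" using assms by (auto simp: n_def le_nat_floor)
  have P: "prime p" "p > 0" "p \<le> n" if "p \<in> P" for p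
    using that by (auto simp: P_def n_def le_nat_floor prime_gt_0_nat)
  have fin: "finite P" by (simp add: P_def)
  have "(\<Prod>p\<in>P. p ^ (n div p)) dvd fact n"
  proof (rule prod_prime_powers_dvd[OF fin])
    show "p ^ (n div p) dvd fact n" if "p \<in> P" for p
      using power_dvd_fact[of p "n div p"] P[OF that]
      by (meson dvd_trans fact_dvd times_div_less_eq_dividend)
  qed (use P in auto)
  then have "(\<Prod>p\<in>P. p ^ (n div p)) \<le> fact n" by (simp add: dvd_imp_le)
  also have "fact n \<le> n ^ n" using fact_le_power[of n, where 'a = nat] by simp
  finally have "real (\<Prod>p\<in>P. p ^ (n div p)) \<le> real (n ^ n)" by (rule of_nat_mono)
  moreover have "(\<Prod>p\<in>P. real p ^ (n div p)) > 0" using P by (intro prod_pos) auto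
  ultimately have "ln (\<Prod>p\<in>P. real p ^ (n div p)) \<le> ln (real n ^ n)" using n by simp
  moreover have "ln (\<Prod>p\<in>P. real p ^ (n div p)) = (\<Sum>p\<in>P. real (n div p) * ln (real p))"
    using P by (subst ln_prod) (auto simp: fin ln_realpow)
  ultimately have le: "(\<Sum>p\<in>P. real (n div p) * ln (real p)) \<le> real n * ln (real n)"
    using n by (simp add: ln_realpow)
  have "real n * (\<Sum>p\<in>P. ln (real p) / real p) = (\<Sum>p\<in>P. real n / real p * ln (real p))"
    by (simp add: sum_distrib_left)
  \<comment> \<open>As \<open>p \<le> n\<close>, the integer quotient is at least 1, so rounding
    \<open>n / p\<close> down loses at most a factor 2.\<close>
  also have "\<dots> \<le> (\<Sum>p\<in>P. 2 * real (n div p) * ln (real p))"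
  proof (intro sum_mono mult_right_mono)
    fix p assume p: "p \<in> P"
    have "n div p \<ge> 1" using P[OF p] by (simp add: Suc_le_eq div_greater_zero_iff)
    then have "p \<le> p * (n div p)" by simp
    moreover have "n < p * (n div p) + p" using P[OF p] by (metis add_less_cancel_left mod_less_divisor mult_div_mod_eq)
    ultimately have "n \<le> 2 * (p * (n div p))" by linarith
    then have "real n \<le> 2 * (real p * real (n div p))" by (metis of_nat_le_iff of_nat_mult of_nat_numeral)
    then show "real n / real p \<le> 2 * real (n div p)" using P[OF p] by (simp add: field_simps)
    show "0 \<le> ln (real p)" using P[OF p] by simp
  qed
  also have "\<dots> \<le> 2 * (real n * ln (real n))"
    using le by (simp add: sum_distrib_left mult.assoc flip: sum_distrib_left)
  finally have "(\<Sum>p\<in>P. ln (real p) / real p) \<le> 2 * ln (real n)" using n by simp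
  also have "\<dots> \<le> 2 * ln t" using n by simp
  finally show ?thesis by (simp add: P_def)
qed

text \<open>Telescoping, since \<open>1 / n ^ 2 \<le> 1 / (n - 1) - 1 / n\<close>. It controls the
  quadratic error of the logarithm in Euler products and the square parts of integers.\<close>

lemma sum_inverse_squares_le_1:
  fixes S :: "nat set"
  assumes "finite S" "\<And>n. n \<in> S \<Longrightarrow> n \<ge> 2"
  shows "(\<Sum>n\<in>S. 1 / real n ^ 2) \<le> 1"
proof -
  have *: "(\<Sum>n\<in>{2..m+2}. 1 / real n ^ 2) \<le> 1 - 1 / real (m + 2)" for m
  proof (induction m)
    case (Suc m)
    have "1 / (real m + 3) ^ 2 \<le> 1 / (real m + 2) - 1 / (real m + 3)"
    proof -
      have "1 / (real m + 3) ^ 2 \<le> 1 / ((real m + 2) * (real m + 3))"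
        unfolding power2_eq_square by (intro divide_left_mono mult_right_mono) auto
      also have "\<dots> = 1 / (real m + 2) - 1 / (real m + 3)" by (simp add: field_simps)
      finally show ?thesis .
    qed
    then show ?case using Suc by (simp add: algebra_simps)
  qed (simp add: power2_eq_square)
  have "S \<subseteq> {2..Max S + 2}"
  proof
    show "x \<in> {2..Max S + 2}" if "x \<in> S" for x
      using Max_ge[OF assms(1) that] assms(2)[OF that] by simp
  qed
  then have "(\<Sum>n\<in>S. 1 / real n ^ 2) \<le> (\<Sum>n\<in>{2..Max S + 2}. 1 / real n ^ 2)"
    by (intro sum_mono2) auto
  also have "\<dots> \<le> 1" using *[of "Max S"] by (smt (verit) divide_nonneg_nonneg of_nat_0_le_iff)
  finally show ?thesis .
qed

section \<open>Euler products and Mertens bounds\<close>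

lemma prime_factors_prod_primes:
  fixes S :: "nat set"
  assumes "finite S" "\<And>p. p \<in> S \<Longrightarrow> prime p"
  shows "prime_factors (\<Prod>S) = S"
proof -
  have "0 \<notin> id ` S" using assms(2) by force
  then have "prime_factors (\<Prod>p\<in>S. id p) = (\<Union>p\<in>S. prime_factors p)"
    using assms(1) by (subst prime_factors_prod) auto
  also have "\<dots> = S" using assms(2) by (auto simp: prime_prime_factors)
  finally show ?thesis by simp
qed

text \<open>Expanding the product gives one term for each subset of \<open>P\<close>, and by unique
  factorisation different subsets have different products.\<close>

lemma prod_one_plus_powr:
  fixes P :: "nat set"
  assumes "finite P" "\<And>p. p \<in> P \<Longrightarrow> prime p"
  shows "(\<Prod>p\<in>P. 1 + real p powr s) = (\<Sum>n\<in>Prod ` Pow P. real n powr s)"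
proof -
  have "inj_on Prod (Pow P)"
  proof (rule inj_on_inverseI[where g = prime_factors])
    show "prime_factors (\<Prod>S) = S" if "S \<in> Pow P" for S
      using that assms by (intro prime_factors_prod_primes) (auto intro: finite_subset)
  qed
  then have "(\<Sum>n\<in>Prod ` Pow P. real n powr s) = (\<Sum>S\<in>Pow P. real (\<Prod>S) powr s)"
    by (subst sum.reindex) auto
  also have "\<dots> = (\<Sum>S\<in>Pow P. (\<Prod>p\<in>S. real p powr s))"
    by (intro sum.cong refl) (simp add: prod_powr_distrib)
  also have "\<dots> = (\<Prod>p\<in>P. real p powr s + 1)"
    using assms(1) by (subst prod_add) auto
  finally show ?thesis by (simp add: add.commute)
qed

text \<open>Take logarithms and use \<open>ln (1 + v) \<ge> v - v ^ 2\<close>; since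
  \<open>s \<le> -1\<close>, the squares are at most \<open>1 / p ^ 2\<close> and sum to at most
  1.\<close>

lemma exp_sum_le_prod_one_plus_powr:
  fixes P :: "nat set"
  assumes "finite P" "\<And>p. p \<in> P \<Longrightarrow> prime p" "s \<le> -1"
  shows "exp ((\<Sum>p\<in>P. real p powr s) - 1) \<le> (\<Prod>p\<in>P. 1 + real p powr s)"
proof -
  have P: "p \<ge> 2" if "p \<in> P" for p using assms(2)[OF that] by (simp add: prime_ge_2_nat)
  have "(\<Sum>p\<in>P. real p powr s) - 1 \<le> (\<Sum>p\<in>P. real p powr s) - (\<Sum>p\<in>P. 1 / real p ^ 2)"
    using sum_inverse_squares_le_1[OF assms(1)] P by simp
  also have "\<dots> = (\<Sum>p\<in>P. real p powr s - 1 / real p ^ 2)" by (simp add: sum_subtractf)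
  also have "\<dots> \<le> (\<Sum>p\<in>P. ln (1 + real p powr s))"
  proof (intro sum_mono)
    fix p assume p: "p \<in> P"
    have "real p powr s \<le> real p powr (-1)" using P[OF p] assms(3) by (intro powr_mono) auto
    then have le: "real p powr s \<le> 1 / real p" using P[OF p] by (simp add: powr_minus_divide)
    also have "\<dots> \<le> 1" using P[OF p] by simp
    finally have "real p powr s - (real p powr s)\<^sup>2 \<le> ln (1 + real p powr s)"
      by (intro ln_one_plus_pos_lower_bound) auto
    moreover have "(real p powr s)\<^sup>2 \<le> (1 / real p)\<^sup>2" using le by (intro power_mono) auto
    ultimately show "real p powr s - 1 / real p ^ 2 \<le> ln (1 + real p powr s)"
      by (simp add: power_divide)
  qed
  finally have "exp ((\<Sum>p\<in>P. real p powr s) - 1) \<le> exp (\<Sum>p\<in>P. ln (1 + real p powr s))" by simp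
  also have "\<dots> = (\<Prod>p\<in>P. 1 + real p powr s)"
    using assms(1) by (simp add: exp_sum add_pos_nonneg)
  finally show ?thesis .
qed

text \<open>With \<open>\<epsilon> = 1 / ln t\<close>, replacing \<open>1 / p\<close> by \<open>p powr (-1 - \<epsilon>)\<close> costs only \<open>O(1)\<close>, and the resulting
  Euler product is dominated by a sum over all integers, which is \<open>O(1 / \<epsilon>)\<close>.\<close>

lemma sum_inverse_primes_le:
  assumes "t \<ge> exp 1"
  shows "(\<Sum>p\<in>{p::nat. prime p \<and> real p \<le> t}. 1 / real p) \<le> ln (ln t) + 6"
proof -
  define P where "P = {p::nat. prime p \<and> real p \<le> t}"
  have fin: "finite P" by (simp add: P_def)
  have "t > 0" using assms by (meson exp_gt_zero less_le_trans)
  have t: "ln t \<ge> 1" "t > 1"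
    using assms \<open>t > 0\<close> by (auto simp: ln_ge_iff intro: less_le_trans[of 1 "exp 1"])
  define \<epsilon> where "\<epsilon> = 1 / ln t"
  have \<epsilon>: "0 < \<epsilon>" "\<epsilon> \<le> 1" using t by (auto simp: \<epsilon>_def)
  have P: "prime p" "p \<ge> 2" if "p \<in> P" for p using that by (auto simp: P_def prime_ge_2_nat)
  \<comment> \<open>Convexity of the exponential bounds the loss at \<open>p\<close> by
    \<open>\<epsilon> * ln p / p\<close>; these losses sum to at most 2.\<close>
  have "(\<Sum>p\<in>P. 1 / real p) \<le> (\<Sum>p\<in>P. real p powr (-1 - \<epsilon>) + \<epsilon> * (ln (real p) / real p))"
  proof (intro sum_mono)
    fix p assume p: "p \<in> P"
    have "1 - \<epsilon> * ln (real p) \<le> real p powr (- \<epsilon>)"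
      using exp_ge_add_one_self[of "- \<epsilon> * ln (real p)"] P[OF p] by (simp add: powr_def)
    moreover have "real p powr (-1 - \<epsilon>) = real p powr (- \<epsilon>) / real p"
      using P[OF p] powr_add[of "real p" "-1" "-\<epsilon>"] by (simp add: powr_minus_divide)
    ultimately show "1 / real p \<le> real p powr (-1 - \<epsilon>) + \<epsilon> * (ln (real p) / real p)"
      using P[OF p] by (simp add: field_simps)
  qed
  also have "\<dots> = (\<Sum>p\<in>P. real p powr (-1 - \<epsilon>)) + \<epsilon> * (\<Sum>p\<in>P. ln (real p) / real p)"
    by (simp add: sum.distrib sum_distrib_left)
  also have "\<epsilon> * (\<Sum>p\<in>P. ln (real p) / real p) \<le> \<epsilon> * (2 * ln t)"
    unfolding P_def using \<epsilon> t by (intro mult_left_mono sum_ln_over_prime_le) auto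
  also have "\<epsilon> * (2 * ln t) = 2" using t by (simp add: \<epsilon>_def)
  also have "(\<Sum>p\<in>P. real p powr (-1 - \<epsilon>)) \<le> ln (8 * ln t) + 1"
  proof -
    have "exp ((\<Sum>p\<in>P. real p powr (-1 - \<epsilon>)) - 1) \<le> (\<Prod>p\<in>P. 1 + real p powr (-1 - \<epsilon>))"
      using \<epsilon> P by (intro exp_sum_le_prod_one_plus_powr fin) auto
    also have "\<dots> = (\<Sum>n\<in>Prod ` Pow P. real n powr (-1 - \<epsilon>))"
      using P by (intro prod_one_plus_powr fin) auto
    also have "\<dots> \<le> 8 * 1 / \<epsilon>"
    proof (rule sum_powr_le_of_count_le[where a = 1])
      show pos: "1 \<le> real n" if n: "n \<in> Prod ` Pow P" for n
      proof -
        obtain S where "S \<subseteq> P" "n = \<Prod>S" using n by auto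
        then have "n \<noteq> 0" using P fin by (metis (no_types, lifting) not_prime_0 prod_zero_iff finite_subset subsetD)
        then show ?thesis by simp
      qed
      show "real (card {n \<in> Prod ` Pow P. real n \<le> x}) \<le> 1 * x" if "1 \<le> x" for x
      proof -
        have "{n \<in> Prod ` Pow P. real n \<le> x} \<subseteq> {1..nat \<lfloor>x\<rfloor>}"
          using pos by (force simp: le_nat_floor)
        then have "card {n \<in> Prod ` Pow P. real n \<le> x} \<le> card {1..nat \<lfloor>x\<rfloor>}"
          by (intro card_mono) auto
        then have "real (card {n \<in> Prod ` Pow P. real n \<le> x}) \<le> real (nat \<lfloor>x\<rfloor>)" by simp
        also have "\<dots> \<le> x" using that by simp
        finally show ?thesis by simp
      qed
    qed (use fin \<epsilon> in auto)
    also have "8 * 1 / \<epsilon> = 8 * ln t" by (simp add: \<epsilon>_def)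
    finally have "(\<Sum>p\<in>P. real p powr (-1 - \<epsilon>)) - 1 \<le> ln (8 * ln t)"
      using t by (subst ln_ge_iff) auto
    then show ?thesis by simp
  qed
  \<comment> \<open>The constant 6 is made up of 3 for \<open>ln 8\<close>, 1 from the Euler product
    and 2 from the change of weights.\<close>
  also have "ln (8 * ln t) = ln 8 + ln (ln t)" using t by (simp add: ln_mult)
  also have "ln (8::real) = 3 * ln 2" using ln_realpow[of 2 3] by simp
  also have "\<dots> \<le> 3" using ln_2_less_1 by simp
  finally show ?thesis by (simp add: P_def)
qed

text \<open>Factor \<open>n = a m\<^sup>2\<close> with \<open>a\<close> squarefree in the harmonic sum.\<close>

lemma sum_inverse_primes_ge:
  assumes "t > 1"
  shows "ln (ln t) - 1 \<le> (\<Sum>p\<in>{p::nat. prime p \<and> real p \<le> t}. 1 / real p)"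
proof -
  define P where "P = {p::nat. prime p \<and> real p \<le> t}"
  define N where "N = nat \<lfloor>t\<rfloor>"
  have fin: "finite P" by (simp add: P_def)
  have P: "prime p" "p \<ge> 2" if "p \<in> P" for p using that by (auto simp: P_def prime_ge_2_nat)
  have "ln t \<le> ln (real N + 1)"
    using assms by (subst ln_le_cancel_iff) (auto simp: N_def, linarith)
  also have "\<dots> \<le> harm N" by (rule ln_le_harm)
  also have "harm N = (\<Sum>n\<in>{1..N}. 1 / real n)" by (simp add: harm_def inverse_eq_divide)
  also have "\<dots> = (\<Sum>n\<in>{1..N}. 1 / real (squarefree_part n) * (1 / real (square_part n) ^ 2))"
    by (intro sum.cong refl, subst (1) squarefree_decompose) simp
  also have "\<dots> = (\<Sum>(a, m)\<in>(\<lambda>n. (squarefree_part n, square_part n)) ` {1..N}. 1 / real a * (1 / real m ^ 2))"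
    by (subst sum.reindex) (auto intro!: inj_onI, metis squarefree_decompose)
  \<comment> \<open>Allowing all pairs of a squarefree product of primes from \<open>P\<close> and a
    square root decouples the double sum into two factors.\<close>
  also have "\<dots> \<le> (\<Sum>(a, m)\<in>(Prod ` Pow P) \<times> {1..N+1}. 1 / real a * (1 / real m ^ 2))"
  proof (intro sum_mono2)
    show "(\<lambda>n. (squarefree_part n, square_part n)) ` {1..N} \<subseteq> Prod ` Pow P \<times> {1..N+1}"
    proof clarify
      fix n assume n: "n \<in> {1..N}"
      have dvd: "squarefree_part n dvd n" "square_part n ^ 2 dvd n"
        using squarefree_decompose[of n] by (metis dvd_triv_left, metis dvd_triv_right)
      have "square_part n dvd n" using dvd(2) by (meson dvd_trans dvd_power pos2)
      then have "square_part n \<le> N" using n by (auto dest: dvd_imp_le)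
      moreover have "square_part n \<noteq> 0" using n by simp
      then have "1 \<le> square_part n" by linarith
      moreover have "squarefree_part n = \<Prod>(prime_factors (squarefree_part n))"
      proof -
        have "multiplicity p (squarefree_part n) = 1" if "p \<in> prime_factors (squarefree_part n)" for p
          using squarefree_factorial_semiring'[of "squarefree_part n"] that by auto
        moreover have "squarefree_part n
            = (\<Prod>p\<in>prime_factors (squarefree_part n). p ^ multiplicity p (squarefree_part n))"
          by (rule prime_factorization_nat) (simp add: zero_less_iff_neq_zero)
        ultimately show ?thesis by (metis (no_types, lifting) power_one_right prod.cong)
      qed
      moreover have "prime_factors (squarefree_part n) \<subseteq> P"
      proof
        fix p assume p: "p \<in> prime_factors (squarefree_part n)"
        then have "p dvd n" "prime p" using dvd by (auto intro: dvd_trans)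
        then have "p \<le> N" using n by (auto dest: dvd_imp_le)
        moreover have "real N \<le> t" using assms by (simp add: N_def)
        ultimately show "p \<in> P" using \<open>prime p\<close> by (auto simp: P_def)
      qed
      ultimately show "squarefree_part n \<in> Prod ` Pow P \<and> square_part n \<in> {1..N+1}" by auto
    qed
  qed (use fin in \<open>auto intro!: mult_nonneg_nonneg prod_nonneg\<close>)
  also have "\<dots> = (\<Sum>a\<in>Prod ` Pow P. 1 / real a) * (\<Sum>m\<in>{1..N+1}. 1 / real m ^ 2)"
    by (simp only: sum_product sum.cartesian_product)
  also have "(\<Sum>m\<in>{1..N+1}. 1 / real m ^ 2) \<le> 2"
  proof -
    have "{1..N+1} = insert 1 {2..N+1}" by auto
    then show ?thesis using sum_inverse_squares_le_1[of "{2..N+1}"] by simp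
  qed
  also have "(\<Sum>a\<in>Prod ` Pow P. 1 / real a) = (\<Sum>a\<in>Prod ` Pow P. real a powr (-1))"
    by (intro sum.cong refl) (simp add: powr_minus_divide)
  also have "\<dots> = (\<Prod>p\<in>P. 1 + real p powr (-1))"
    using P by (intro prod_one_plus_powr[symmetric] fin) auto
  also have "\<dots> \<le> (\<Prod>p\<in>P. exp (1 / real p))"
    by (intro prod_mono) (simp add: powr_minus_divide)
  also have "\<dots> = exp (\<Sum>p\<in>P. 1 / real p)" by (simp add: exp_sum fin)
  \<comment> \<open>The factor 2 from the squares is absorbed into \<open>exp 1\<close>; this is the
    constant -1 of the bound.\<close>
  also have "\<dots> * 2 \<le> exp (\<Sum>p\<in>P. 1 / real p) * exp 1"
    using exp_ge_add_one_self[of 1] by (intro mult_left_mono) auto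
  finally have "ln t \<le> exp ((\<Sum>p\<in>P. 1 / real p) + 1)"
    using sum_nonneg[of "Prod ` Pow P" "\<lambda>a. 1 / real a"]
    by (simp add: exp_add mult_left_mono del: of_nat_prod)
  then have "ln (ln t) \<le> (\<Sum>p\<in>P. 1 / real p) + 1"
    using assms by (metis ln_exp ln_le_cancel_iff exp_gt_zero ln_gt_zero)
  then show ?thesis by (simp add: P_def)
qed

subsection \<open>Products of primes\<close>

text \<open>Repetitions are allowed. The values form a set, so each integer is counted once however
  many orderings produce it, as the counting bound on \<open>f n = 1\<close> requires.\<close>

fun fold_products :: "nat set \<Rightarrow> nat \<Rightarrow> nat set" where
  "fold_products G 0 = {1}"
| "fold_products G (Suc k) = (\<lambda>(p, n). p * n) ` (G \<times> fold_products G k)"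

lemma finite_fold_products: "finite G \<Longrightarrow> finite (fold_products G k)"
  by (induction k) auto

text \<open>The cardinality bound limits how often an integer arises as a product; the inclusion in
  \<open>G\<close> later yields coprimality with products over a disjoint set.\<close>

lemma prime_factors_fold_products:
  assumes "\<And>p. p \<in> G \<Longrightarrow> prime p" "n \<in> fold_products G k"
  shows "n > 0 \<and> prime_factors n \<subseteq> G \<and> card (prime_factors n) \<le> k"
  using assms(2)
proof (induction k arbitrary: n)
  case (Suc k)
  then obtain p m where pm: "p \<in> G" "m \<in> fold_products G k" "n = p * m" by auto
  have "prime p" using assms(1) pm by simp
  have m: "m > 0" "prime_factors m \<subseteq> G" "card (prime_factors m) \<le> k"
    using Suc.IH[OF pm(2)] by auto
  have "prime_factors n = insert p (prime_factors m)"
    using \<open>prime p\<close> m pm(3) by (simp add: prime_factors_product prime_prime_factors prime_gt_0_nat)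
  then show ?case using \<open>prime p\<close> m pm by (auto simp: prime_gt_0_nat card_insert_if)
qed simp

lemma power_le_fold_products:
  assumes "\<And>p. p \<in> G \<Longrightarrow> z \<le> real p" "0 \<le> z" "n \<in> fold_products G k"
  shows "z ^ k \<le> real n"
  using assms(3)
proof (induction k arbitrary: n)
  case (Suc k)
  then obtain p m where pm: "p \<in> G" "m \<in> fold_products G k" "n = p * m" by auto
  then show ?case using Suc.IH[OF pm(2)] assms(1,2) by (auto intro!: mult_mono)
qed simp

text \<open>In the induction step, each element of \<open>fold_products G (Suc k)\<close> arises from at most \<open>Suc k\<close> pairs,
  one for each of its prime divisors.\<close>

lemma power_sum_le_fold_products:
  assumes fin: "finite G" and G: "\<And>p. p \<in> G \<Longrightarrow> prime p"
  shows "(\<Sum>p\<in>G. real p powr s) ^ k \<le> fact k * (\<Sum>n\<in>fold_products G k. real n powr s)"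
proof (induction k)
  case (Suc k)
  let ?A = "fold_products G"
  let ?S = "\<Sum>p\<in>G. real p powr s"
  have finA: "finite (?A k)" for k using fin by (rule finite_fold_products)
  have fibre: "(\<Sum>x\<in>{x \<in> G \<times> ?A k. (\<lambda>(p, n). p * n) x = N}. real N powr s) \<le> (real k + 1) * real N powr s"
    if N: "N \<in> ?A (Suc k)" for N
  proof -
    let ?F = "{x \<in> G \<times> ?A k. (\<lambda>(p, n). p * n) x = N}"
    have N': "N > 0" "card (prime_factors N) \<le> Suc k"
      using prime_factors_fold_products[OF G N] by auto
    \<comment> \<open>The prime \<open>p\<close> determines the cofactor \<open>N div p\<close>, so
      the pairs over \<open>N\<close> inject into its prime divisors.\<close>
    have "inj_on fst ?F" using N' by (auto simp: inj_on_def)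
    then have "card ?F = card (fst ` ?F)" by (simp add: card_image)
    also have "\<dots> \<le> card (prime_factors N)"
      using N' G by (intro card_mono) (auto simp: prime_factors_dvd)
    finally have "real (card ?F) \<le> real k + 1" using N'(2) by linarith
    then show ?thesis by (simp add: mult_right_mono)
  qed
  have "?S * (\<Sum>n\<in>?A k. real n powr s) = (\<Sum>(p, n)\<in>G \<times> ?A k. real p powr s * real n powr s)"
    by (simp only: sum_product sum.cartesian_product)
  also have "\<dots> = (\<Sum>x\<in>G \<times> ?A k. real ((\<lambda>(p, n). p * n) x) powr s)"
    by (intro sum.cong refl) (auto simp: powr_mult)
  also have "\<dots> = (\<Sum>N\<in>?A (Suc k). \<Sum>x\<in>{x \<in> G \<times> ?A k. (\<lambda>(p, n). p * n) x = N}.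
      real ((\<lambda>(p, n). p * n) x) powr s)"
    using fin finA by (subst sum.image_gen[where g = "\<lambda>(p, n). p * n"]) auto
  also have "\<dots> = (\<Sum>N\<in>?A (Suc k). \<Sum>x\<in>{x \<in> G \<times> ?A k. (\<lambda>(p, n). p * n) x = N}. real N powr s)"
    by (intro sum.cong refl) auto
  also have "\<dots> \<le> (\<Sum>N\<in>?A (Suc k). (real k + 1) * real N powr s)"
    by (intro sum_mono fibre)
  finally have step: "?S * (\<Sum>n\<in>?A k. real n powr s) \<le> (real k + 1) * (\<Sum>N\<in>?A (Suc k). real N powr s)"
    by (simp only: sum_distrib_left)
  have "?S ^ Suc k \<le> ?S * (fact k * (\<Sum>n\<in>?A k. real n powr s))"
    using Suc.IH by (simp add: mult_left_mono sum_nonneg)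
  also have "\<dots> \<le> fact k * ((real k + 1) * (\<Sum>N\<in>?A (Suc k). real N powr s))"
    using mult_left_mono[OF step, of "fact k"] by (simp add: mult.left_commute)
  finally show ?case by (simp add: algebra_simps)
qed simp

lemma compl_mult_roots_mult:
  "compl_mult_roots d f \<Longrightarrow> m \<ge> 1 \<Longrightarrow> n \<ge> 1 \<Longrightarrow> f (m * n) = f m * f n"
  by (simp add: compl_mult_roots_def)

lemma compl_mult_roots_fold_products:
  assumes f: "compl_mult_roots d f" and G: "\<And>p. p \<in> G \<Longrightarrow> prime p \<and> f p = 1"
    and "n \<in> fold_products G k"
  shows "f n = 1"
  using assms(3)
proof (induction k arbitrary: n)
  case 0
  then show ?case using f by (simp add: compl_mult_roots_def)
next
  case (Suc k)
  then obtain p m where pm: "p \<in> G" "m \<in> fold_products G k" "n = p * m" by auto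
  moreover have "m \<ge> 1"
    using prime_factors_fold_products[of G m k] G pm by (simp add: Suc_le_eq)
  moreover have "p \<ge> 1" using G[OF pm(1)] prime_ge_1_nat by blast
  ultimately show ?case using G Suc.IH[OF pm(2)] compl_mult_roots_mult[OF f, of p m] by simp
qed

lemma compl_mult_roots_prod:
  assumes f: "compl_mult_roots d f" and "finite S" and S: "\<And>p. p \<in> S \<Longrightarrow> prime p \<and> f p = 1"
  shows "f (\<Prod>S) = 1"
  using assms(2,3)
proof (induction S)
  case empty
  then show ?case using f by (simp add: compl_mult_roots_def)
next
  case (insert p S)
  then have "\<Prod>S \<noteq> 0" by (metis insertCI not_prime_0 prod_zero_iff)
  then have "\<Prod>S \<ge> 1" by linarith
  moreover have "p \<ge> 1" using insert.prems[of p] prime_ge_1_nat by blast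
  ultimately have "f (p * \<Prod>S) = f p * f (\<Prod>S)" by (intro compl_mult_roots_mult[OF f])
  then show ?case using insert by simp
qed

text \<open>Disjointness of \<open>G\<close> and \<open>P\<close> makes the two kinds of products
  coprime, so every element of \<open>T\<close> splits in only one way and the weighted sum
  factorises. The \<open>k!\<close> is the loss from orderings in
  \<open>power_sum_le_fold_products\<close>.\<close>

lemma fold_products_times_prod:
  assumes fin: "finite G" "finite P" and disj: "G \<inter> P = {}"
    and f: "compl_mult_roots d f"
    and G: "\<And>p. p \<in> G \<Longrightarrow> prime p \<and> f p = 1 \<and> z \<le> real p" and "z \<ge> 0"
    and P: "\<And>p. p \<in> P \<Longrightarrow> prime p \<and> f p = 1"
  obtains T where "finite T" "\<And>n. n \<in> T \<Longrightarrow> f n = 1 \<and> z ^ k \<le> real n"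
    "(\<Sum>p\<in>G. real p powr s) ^ k / fact k * (\<Prod>p\<in>P. 1 + real p powr s) \<le> (\<Sum>n\<in>T. real n powr s)"
proof
  let ?A = "fold_products G k" and ?B = "Prod ` Pow P"
  define T where "T = (\<lambda>(n, m). n * m) ` (?A \<times> ?B)"
  have finA: "finite ?A" using fin by (simp add: finite_fold_products)
  show "finite T" unfolding T_def using fin finA by simp
  have A: "n > 0" "prime_factors n \<subseteq> G" "f n = 1" "z ^ k \<le> real n" if "n \<in> ?A" for n
    using prime_factors_fold_products[OF _ that] compl_mult_roots_fold_products[OF f _ that]
      power_le_fold_products[OF _ \<open>z \<ge> 0\<close> that] G by blast+
  have B: "m > 0 \<and> prime_factors m \<subseteq> P \<and> f m = 1" if m: "m \<in> ?B" for m
  proof -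
    obtain S where S: "S \<subseteq> P" "m = \<Prod>S" using m by auto
    have "finite S" using S fin finite_subset by blast
    moreover have "\<Prod>S > 0" unfolding zero_less_iff_neq_zero using S P \<open>finite S\<close> by (metis not_prime_0 prod_zero_iff subsetD)
    moreover have "prime_factors (\<Prod>S) = S"
      using S P \<open>finite S\<close> by (intro prime_factors_prod_primes) auto
    moreover have "f (\<Prod>S) = 1"
      using S P by (intro compl_mult_roots_prod[OF f \<open>finite S\<close>]) auto
    ultimately show ?thesis using S by metis
  qed
  show "f N = 1 \<and> z ^ k \<le> real N" if N: "N \<in> T" for N
  proof -
    obtain n m where nm: "n \<in> ?A" "m \<in> ?B" "N = n * m" using N by (auto simp: T_def)
    have "z ^ k \<le> real n * 1" using A(4)[OF nm(1)] by simp
    also have "\<dots> \<le> real n * real m" using B[OF nm(2)] by (intro mult_left_mono) auto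
    finally show ?thesis
      using nm A[OF nm(1)] B[OF nm(2)] compl_mult_roots_mult[OF f, of n m] by (simp add: Suc_le_eq)
  qed
  have cop: "coprime n m" if "n \<in> ?A" "m \<in> ?B" for n m
  proof (rule ccontr)
    assume "\<not> coprime n m"
    then obtain p where p: "prime p" "p dvd gcd n m"
      using prime_factor_nat[of "gcd n m"] by (auto simp: coprime_iff_gcd_eq_1)
    then have "p \<in> prime_factors n" "p \<in> prime_factors m"
      using A(1)[OF that(1)] B[OF that(2)] by (auto simp: prime_factors_dvd)
    then show False using A(2)[OF that(1)] B[OF that(2)] disj by blast
  qed
  \<comment> \<open>If \<open>n * m = n' * m'\<close>, then \<open>n\<close> is coprime to
    \<open>m'\<close> and so divides \<open>n'\<close>; by symmetry the two are equal.\<close>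
  have "inj_on (\<lambda>(n, m). n * m) (?A \<times> ?B)"
  proof (rule inj_onI)
    fix x y
    assume xy: "x \<in> ?A \<times> ?B" "y \<in> ?A \<times> ?B" "(\<lambda>(n, m). n * m) x = (\<lambda>(n, m). n * m) y"
    obtain n m n' m' where [simp]: "x = (n, m)" "y = (n', m')" by (metis surj_pair)
    have nm: "n \<in> ?A" "n' \<in> ?A" "m \<in> ?B" "m' \<in> ?B" and eq: "n * m = n' * m'"
      using xy by (simp_all only: mem_Times_iff fst_conv snd_conv case_prod_conv \<open>x = _\<close> \<open>y = _\<close>)
    have "n dvd n' * m'" "n' dvd n * m" using eq by (metis dvd_triv_left)+
    then have "n dvd n'" "n' dvd n"
      using cop nm by (simp_all add: coprime_dvd_mult_left_iff)
    then have "n = n'" by (rule dvd_antisym)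
    then show "x = y" using eq A(1)[OF nm(2)] by simp
  qed
  then have "(\<Sum>N\<in>T. real N powr s) = (\<Sum>(n, m)\<in>?A \<times> ?B. real (n * m) powr s)"
    unfolding T_def by (subst sum.reindex) (auto simp: case_prod_beta)
  also have "\<dots> = (\<Sum>n\<in>?A. real n powr s) * (\<Sum>m\<in>?B. real m powr s)"
    by (simp only: of_nat_mult powr_mult of_nat_0_le_iff sum_product sum.cartesian_product)
  also have "(\<Sum>m\<in>?B. real m powr s) = (\<Prod>p\<in>P. 1 + real p powr s)"
    using P fin by (intro prod_one_plus_powr[symmetric]) auto
  also have "(\<Sum>p\<in>G. real p powr s) ^ k / fact k * (\<Prod>p\<in>P. 1 + real p powr s)
      \<le> (\<Sum>n\<in>?A. real n powr s) * (\<Prod>p\<in>P. 1 + real p powr s)"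
    using power_sum_le_fold_products[of G s k] fin G
    by (intro mult_right_mono prod_nonneg) (auto simp: field_simps)
  finally show "(\<Sum>p\<in>G. real p powr s) ^ k / fact k * (\<Prod>p\<in>P. 1 + real p powr s) \<le> (\<Sum>n\<in>T. real n powr s)" .
qed

subsection \<open>The classes of multiplicative functions\<close>

lemma finite_nats_le: "finite {n::nat. real n \<le> x}"
proof -
  have "{n::nat. real n \<le> x} \<subseteq> {..nat \<lfloor>x\<rfloor>}" by (auto simp: le_nat_floor)
  then show ?thesis using finite_subset by blast
qed

lemma classM_card_le:
  assumes f: "f \<in> classM x0 d" and "x \<ge> x0" "x \<ge> 0"
  shows "real (card {n::nat. 1 \<le> n \<and> real n \<le> x \<and> f n = 1}) \<le> 100 / real d * x"
proof -
  have "real (card {n::nat. 1 \<le> n \<and> real n \<le> x \<and> f n = 1})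
      \<le> 100 * x / real d * (\<Prod>p\<in>{p::nat. prime p \<and> real p \<le> x \<and> f p = 0}. 1 - 1 / real p)"
    using f \<open>x \<ge> x0\<close> by (simp add: classM_def)
  also have "\<dots> \<le> 100 * x / real d * 1"
    using \<open>x \<ge> 0\<close> by (intro mult_left_mono prod_le_1) (auto dest: prime_gt_0_nat)
  finally show ?thesis by simp
qed

text \<open>Because \<open>f 1 = 1\<close>, the count at \<open>x0\<close> is at least 1, while its
  upper bound is \<open>100 * x0 / d\<close>.\<close>

lemma classM_degree_le:
  assumes f: "f \<in> classM x0 d" and "d \<ge> 1" "x0 \<ge> 1"
  shows "real d \<le> 100 * x0"
proof -
  let ?N = "{n::nat. 1 \<le> n \<and> real n \<le> x0 \<and> f n = 1}"
  have "1 \<in> ?N" using f \<open>x0 \<ge> 1\<close> by (simp add: classM_def compl_mult_roots_def)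
  moreover have "finite ?N" by (rule finite_subset[OF _ finite_nats_le[of x0]]) auto
  ultimately have "card ?N \<ge> 1" by (metis One_nat_def Suc_leI card_gt_0_iff empty_iff)
  then have "1 \<le> 100 / real d * x0"
    using classM_card_le[OF f, of x0] \<open>x0 \<ge> 1\<close> by linarith
  then show ?thesis using \<open>d \<ge> 1\<close> by (simp add: field_simps)
qed

text \<open>The dyadic bound with \<open>a = x0\<close>, \<open>K = 100 / d\<close> and
  \<open>\<epsilon> = 1 / ln x0\<close>; \<open>x0 \<ge> exp 1\<close> ensures
  \<open>\<epsilon> \<le> 1\<close>.\<close>

lemma classM_sum_powr_le:
  assumes f: "f \<in> classM x0 d" and "x0 \<ge> exp 1" and "finite T"
    and T: "\<And>n. n \<in> T \<Longrightarrow> f n = 1 \<and> x0 \<le> real n"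
  shows "(\<Sum>n\<in>T. real n powr (-1 - 1 / ln x0)) \<le> 800 * ln x0 / real d"
proof -
  have "(1::real) < exp 1" by simp
  then have "x0 > 1" using assms(2) by linarith
  then have "ln x0 \<ge> 1" using assms(2) by (simp add: ln_ge_iff)
  have "(\<Sum>n\<in>T. real n powr (-1 - 1 / ln x0)) \<le> 8 * (100 / real d) / (1 / ln x0)"
  proof (rule sum_powr_le_of_count_le[where a = x0])
    show "real (card {n \<in> T. real n \<le> x}) \<le> 100 / real d * x" if "x0 \<le> x" for x
    proof -
      have "card {n \<in> T. real n \<le> x} \<le> card {n::nat. 1 \<le> n \<and> real n \<le> x \<and> f n = 1}"
      proof (rule card_mono)
        show "finite {n::nat. 1 \<le> n \<and> real n \<le> x \<and> f n = 1}"
          by (rule finite_subset[OF _ finite_nats_le[of x]]) auto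
        show "{n \<in> T. real n \<le> x} \<subseteq> {n::nat. 1 \<le> n \<and> real n \<le> x \<and> f n = 1}"
          using T \<open>x0 > 1\<close> by force
      qed
      then show ?thesis using classM_card_le[OF f that] that \<open>x0 > 1\<close> by linarith
    qed
  qed (use T assms \<open>ln x0 \<ge> 1\<close> \<open>x0 > 1\<close> in auto)
  then show ?thesis by simp
qed

section \<open>The main estimate\<close>

text \<open>For \<open>n \<ge> 2\<close> the step multiplies the left side by
  \<open>exp 1 \<le> 3\<close> and the right side by \<open>n + 1 \<ge> 3\<close>; the constant
  \<open>exp 3\<close> covers the steps before.\<close>

lemma exp_le_fact: "exp (real n) \<le> exp 3 * fact n"
proof (induction n)
  case (Suc n)
  show ?case
  proof (cases "n \<ge> 2")
    case True
    have "exp (real (Suc n)) = exp 1 * exp (real n)" by (simp add: exp_add)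
    also have "\<dots> \<le> real (Suc n) * (exp 3 * fact n)"
      using True exp_le Suc by (intro mult_mono) auto
    finally show ?thesis by (simp add: algebra_simps)
  next
    case False
    then have "exp (real (Suc n)) \<le> exp 3 * 1" by simp
    also have "\<dots> \<le> exp 3 * fact (Suc n)" by (intro mult_left_mono fact_ge_1) auto
    finally show ?thesis .
  qed
qed simp

text \<open>The value of \<open>\<kappa>\<close> makes \<open>ln (1 / \<kappa>)\<close> exceed the bound 100 on the zeros of \<open>f\<close> plus the error terms of
  the two Mertens bounds, with room to spare.\<close>

lemma classM1_sum_inverse_primes_ge:
  fixes \<kappa> C1 C2 :: real
  assumes \<kappa>: "\<kappa> = exp (-110)" and C1: "C1 = 800 * exp 214" and C2: "C2 = 1 / \<kappa> + 3"
  assumes x0: "x0 \<ge> exp 1" and \<eta>: "0 < \<eta>" "\<eta> < 1" and \<delta>: "0 < \<delta>" "\<delta> < 1"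
    and d: "d \<ge> 1" "C1 * inverse (dickman_rho (C2 / (\<eta> * \<delta>))) \<le> real d"
    and f: "f \<in> classM1 x0 d" and x: "x > x0 powr \<delta>"
  shows "ln (1 / \<eta>) \<le> (\<Sum>p\<in>{p::nat. prime p \<and> real p \<le> x \<and> f p \<noteq> 0 \<and> f p \<noteq> 1}. 1 / real p)"
proof (rule ccontr)
  assume small: "\<not> ?thesis"
  define L where "L = ln x0"
  define u where "u = 1 / (\<eta> * \<delta>)"
  \<comment> \<open>\<open>k\<close> and \<open>z\<close> are matched: \<open>z\<close> is
    \<open>x0 powr (\<kappa> / u)\<close> and \<open>k \<ge> u / \<kappa>\<close>, so
    \<open>k\<close> primes above \<open>z\<close> have a product of at least
    \<open>x0\<close>.\<close>
  define k where "k = nat \<lceil>u / \<kappa>\<rceil>"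
  define z where "z = exp (\<kappa> * L / u)"
  define y where "y = x0 powr \<delta>"
  \<comment> \<open>The shift \<open>1 / L\<close> lowers the weight \<open>1 / p\<close> by a
    factor of at most \<open>exp 1\<close> for \<open>p \<le> x0\<close>, yet keeps sums over
    \<open>f n = 1\<close> beyond \<open>x0\<close> of size \<open>L / d\<close>.\<close>
  define s where "s = -1 - 1 / L"
  have "x0 > 0" using x0 by (meson exp_gt_zero less_le_trans)
  have L: "L \<ge> 1" unfolding L_def using x0 \<open>x0 > 0\<close> by (simp add: ln_ge_iff)
  have fM: "f \<in> classM x0 d" and cm: "compl_mult_roots d f"
    and zeros: "(\<Sum>p\<in>{p::nat. prime p \<and> p \<le> N \<and> f p = 0}. 1 / real p) \<le> 100" for N
    using f by (auto simp: classM1_def classM_def)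
  have \<kappa>01: "0 < \<kappa>" "\<kappa> < 1" using \<kappa> by auto
  have "\<eta> * \<delta> < 1" using \<eta> \<delta> mult_strict_mono[of \<eta> 1 \<delta> 1] by simp
  then have u: "u > 1" unfolding u_def using \<eta> \<delta> by simp
  have "1 / \<eta> \<le> u" unfolding u_def using \<eta> \<delta> by (simp add: field_simps mult_le_cancel_left1)
  have k: "u / \<kappa> \<le> real k" "real k \<le> u / \<kappa> + 1"
    unfolding k_def using u \<kappa>01 by (auto simp: real_nat_ceiling_ge)
  have "C1 > 0" using C1 by simp
  have "u \<le> u / \<kappa>" using u \<kappa>01 by (simp add: field_simps)
  \<comment> \<open>Here \<open>C2 = 1 / \<kappa> + 3\<close> comes from: rounding up costs 1, the
    offset costs 2, and \<open>u > 1\<close> turns this 3 into \<open>3 * u\<close>.\<close>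
  have C2u: "real (k + 2) \<le> C2 / (\<eta> * \<delta>)"
  proof -
    have "real (k + 2) \<le> u / \<kappa> + 3 * u" using k u by simp
    also have "\<dots> = C2 / (\<eta> * \<delta>)" by (simp add: C2 u_def add_divide_distrib mult.commute mult.left_commute)
    finally show ?thesis .
  qed
  have "C1 * fact (k + 2) \<le> C1 * inverse (dickman_rho (C2 / (\<eta> * \<delta>)))"
    using C2u \<open>C1 > 0\<close> by (intro mult_left_mono fact_le_inverse_dickman_rho) auto
  then have d_ge: "C1 * fact (k + 2) \<le> real d" using d(2) by linarith

  \<comment> \<open>Taking \<open>n = 1\<close> in the counting bound gives \<open>d \<le> 100 x0\<close>, so \<open>u\<close> cannot be large compared with \<open>L\<close>.\<close>
  have z_ge: "\<kappa> * L / u \<ge> 1"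
  proof -
    have "exp (real k) \<le> exp 3 * fact k" by (rule exp_le_fact)
    also have "\<dots> \<le> exp 3 * fact (k + 2)" by (intro mult_left_mono fact_mono) auto
    \<comment> \<open>The factor \<open>8 * exp 211\<close> is \<open>C1 / (100 * exp 3)\<close>;
      that it is at least 1 gives \<open>exp k \<le> x0\<close>.\<close>
    finally have "8 * exp 211 * exp (real k) \<le> C1 / 100 * fact (k + 2)"
      using exp_add[of 211 "3::real"] by (simp add: C1)
    also have "\<dots> \<le> x0"
    proof -
      have "(1::real) \<le> exp 1" by simp
      then have "x0 \<ge> 1" using x0 by linarith
      then show ?thesis using d_ge classM_degree_le[OF fM d(1)] by simp
    qed
    also have "exp (real k) \<le> 8 * exp 211 * exp (real k)"
    proof -
      have "1 \<le> 8 * exp (211::real)" using exp_ge_add_one_self[of "211::real"] by linarith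
      then show ?thesis by simp
    qed
    finally have "exp (real k) \<le> x0" by simp
    then have "real k \<le> L" unfolding L_def using \<open>x0 > 0\<close> by (simp add: ln_ge_iff)
    then have "u / \<kappa> \<le> L" using k by linarith
    then show ?thesis using u \<kappa>01 by (simp add: field_simps)
  qed
  then have z: "z \<ge> exp 1" "z > 1" "ln z = \<kappa> * L / u"
    unfolding z_def by (auto intro: less_le_trans[of 0 1])
  have ln_y: "ln y = \<delta> * L" unfolding y_def L_def using \<open>x0 > 0\<close> by simp
  have "y > 0" unfolding y_def using \<open>x0 > 0\<close> by simp
  \<comment> \<open>The choice of \<open>z\<close> makes the interval \<open>(z, y]\<close> carry
    prime mass about \<open>110 + ln (1 / \<eta>)\<close>, enough to outweigh the primes with
    \<open>f p \<noteq> 1\<close>.\<close>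
  have lnz_y: "ln z = \<kappa> * \<eta> * ln y" using \<eta> \<delta> by (simp add: z(3) ln_y u_def)
  have "ln y \<ge> ln z"
  proof -
    have "\<kappa> * \<eta> < 1" using \<kappa>01 \<eta> mult_strict_mono[of \<kappa> 1 \<eta> 1] by simp
    moreover have "ln y \<ge> 0" using ln_y \<delta> L by simp
    ultimately show ?thesis unfolding lnz_y by (simp add: mult_left_le_one_le \<kappa>01 \<eta> less_imp_le)
  qed
  then have zy: "z \<le> y"
    using z(2) \<open>y > 0\<close> by (metis ln_le_cancel_iff less_trans zero_less_one)
  have y: "y > 1" using z zy by simp

  \<comment> \<open>Such primes either have \<open>f p = 0\<close>, of total mass at most 100, or
    belong to the sum assumed smaller than \<open>ln (1 / \<eta>)\<close>, since
    \<open>t \<le> y < x\<close>.\<close>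
  have bad: "(\<Sum>p\<in>{p::nat. prime p \<and> real p \<le> t \<and> f p \<noteq> 1}. 1 / real p) \<le> ln (1 / \<eta>) + 100"
    if "t \<le> y" for t
  proof -
    have sub: "{p::nat. prime p \<and> real p \<le> t \<and> f p \<noteq> 1} \<subseteq>
        {p::nat. prime p \<and> real p \<le> x \<and> f p \<noteq> 0 \<and> f p \<noteq> 1}
        \<union> {p::nat. prime p \<and> p \<le> nat \<lfloor>x\<rfloor> \<and> f p = 0}"
      using that x by (auto simp: y_def le_nat_floor)
    have fin: "finite {p::nat. prime p \<and> real p \<le> x \<and> f p \<noteq> 0 \<and> f p \<noteq> 1}"
      by (rule finite_subset[OF _ finite_primes_le[of x]]) auto
    have "(\<Sum>p\<in>{p::nat. prime p \<and> real p \<le> t \<and> f p \<noteq> 1}. 1 / real p)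
        \<le> (\<Sum>p\<in>{p::nat. prime p \<and> real p \<le> x \<and> f p \<noteq> 0 \<and> f p \<noteq> 1}
        \<union> {p::nat. prime p \<and> p \<le> nat \<lfloor>x\<rfloor> \<and> f p = 0}. 1 / real p)"
      using fin by (intro sum_mono2 sub) auto
    also have "\<dots> = (\<Sum>p\<in>{p::nat. prime p \<and> real p \<le> x \<and> f p \<noteq> 0 \<and> f p \<noteq> 1}. 1 / real p)
        + (\<Sum>p\<in>{p::nat. prime p \<and> p \<le> nat \<lfloor>x\<rfloor> \<and> f p = 0}. 1 / real p)"
      using fin by (intro sum.union_disjoint) auto
    also have "\<dots> \<le> ln (1 / \<eta>) + 100" using small zeros by (intro add_mono) auto
    finally show ?thesis .
  qed
  have good: "ln (ln t) - ln (1 / \<eta>) - 101 \<le> (\<Sum>p\<in>{p::nat. prime p \<and> real p \<le> t \<and> f p = 1}. 1 / real p)"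
    if "1 < t" "t \<le> y" for t
  proof -
    have fin: "finite {p::nat. prime p \<and> real p \<le> t \<and> Q p}" for Q
      by (rule finite_subset[OF _ finite_primes_le[of t]]) auto
    have "{p::nat. prime p \<and> real p \<le> t} = {p::nat. prime p \<and> real p \<le> t \<and> f p = 1}
        \<union> {p::nat. prime p \<and> real p \<le> t \<and> f p \<noteq> 1}" by auto
    then have "(\<Sum>p\<in>{p::nat. prime p \<and> real p \<le> t}. 1 / real p)
        = (\<Sum>p\<in>{p::nat. prime p \<and> real p \<le> t \<and> f p = 1}. 1 / real p)
        + (\<Sum>p\<in>{p::nat. prime p \<and> real p \<le> t \<and> f p \<noteq> 1}. 1 / real p)"
      by (simp only:, intro sum.union_disjoint fin) auto
    then show ?thesis using sum_inverse_primes_ge[OF that(1)] bad[OF that(2)] by linarith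
  qed

  define P where "P = {p::nat. prime p \<and> real p \<le> z \<and> f p = 1}"
  define G where "G = {p::nat. prime p \<and> z < real p \<and> real p \<le> y \<and> f p = 1}"
  have fin: "finite P" "finite G" unfolding P_def G_def
    by (rule finite_subset[OF _ finite_primes_le[of z]], blast,
        rule finite_subset[OF _ finite_primes_le[of y]], blast)
  have "P \<inter> G = {}" by (auto simp: P_def G_def)

  have G_sum: "1 \<le> (\<Sum>p\<in>G. real p powr s)"
  proof -
    have "{p::nat. prime p \<and> real p \<le> y \<and> f p = 1} = P \<union> G"
      using zy by (auto simp: P_def G_def)
    then have "ln (ln y) - ln (1 / \<eta>) - 101 \<le> (\<Sum>p\<in>P. 1 / real p) + (\<Sum>p\<in>G. 1 / real p)"
      using good[of y] y \<open>P \<inter> G = {}\<close> fin by (simp add: sum.union_disjoint)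
    moreover have "(\<Sum>p\<in>P. 1 / real p) \<le> ln (ln z) + 6"
    proof -
      have "(\<Sum>p\<in>P. 1 / real p) \<le> (\<Sum>p\<in>{p::nat. prime p \<and> real p \<le> z}. 1 / real p)"
        by (intro sum_mono2) (auto simp: P_def)
      then show ?thesis using sum_inverse_primes_le[OF z(1)] by linarith
    qed
    moreover have "ln (ln z) = -110 - ln (1 / \<eta>) + ln (ln y)"
      unfolding lnz_y using \<kappa>01 \<eta> y by (simp add: ln_mult ln_div \<kappa>)
    \<comment> \<open>The terms \<open>ln (1 / \<eta>)\<close> cancel and
      \<open>110 - 101 - 6 = 3\<close> remains. The factor 3 then pays for the weight change, as
      \<open>p \<le> y \<le> x0\<close> gives
      \<open>p powr (1 / L) \<le> exp 1 \<le> 3\<close>.\<close>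
    ultimately have "3 \<le> (\<Sum>p\<in>G. 1 / real p)" by linarith
    also have "\<dots> \<le> (\<Sum>p\<in>G. 3 * real p powr s)"
    proof (intro sum_mono)
      fix p assume "p \<in> G"
      then have p: "real p > 1" "real p \<le> y" using z by (auto simp: G_def)
      then have "ln (real p) \<le> \<delta> * L" using ln_y by (metis less_trans ln_le_cancel_iff y zero_less_one)
      also have "\<dots> \<le> L" using \<delta> L by simp
      finally have "ln (real p) / L \<le> 1" using L by simp
      then have "real p powr (1 / L) \<le> exp 1" using p by (simp add: powr_def)
      also have "\<dots> \<le> 3" by (rule exp_le)
      finally have "real p powr (1 / L) \<le> 3" .
      then have "real p powr (1 / L) * real p powr s \<le> 3 * real p powr s"
        by (intro mult_right_mono) auto
      moreover have "real p powr (1 / L) * real p powr s = 1 / real p"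
        unfolding s_def using p by (simp add: powr_minus_divide flip: powr_add)
      ultimately show "1 / real p \<le> 3 * real p powr s" by simp
    qed
    also have "\<dots> = 3 * (\<Sum>p\<in>G. real p powr s)" by (simp add: sum_distrib_left)
    finally show ?thesis by simp
  qed

  \<comment> \<open>The exponent is \<open>101 + 2 + 1\<close>: 101 from \<open>good\<close>, 2 from
    the change of weights and 1 from the Euler product bound.\<close>
  have P_prod: "exp (-104) * \<eta> * ln z \<le> (\<Prod>p\<in>P. 1 + real p powr s)"
  proof -
    have "ln (ln z) - ln (1 / \<eta>) - 101 \<le> (\<Sum>p\<in>P. 1 / real p)"
      unfolding P_def using z zy by (intro good) auto
    also have "\<dots> \<le> (\<Sum>p\<in>P. real p powr s + 1 / L * (ln (real p) / real p))"
    proof (intro sum_mono)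
      fix p assume "p \<in> P"
      then have p: "p > 0" by (auto simp: P_def prime_gt_0_nat)
      have "1 - 1 / L * ln (real p) \<le> real p powr (- (1 / L))"
        using exp_ge_add_one_self[of "- (1 / L) * ln (real p)"] p by (simp add: powr_def)
      moreover have "real p powr s = real p powr (- (1 / L)) / real p"
        unfolding s_def using p powr_add[of "real p" "-1" "- (1 / L)"] by (simp add: powr_minus_divide)
      ultimately have "(1 - 1 / L * ln (real p)) / real p \<le> real p powr s"
        by (simp only:, intro divide_right_mono) auto
      then show "1 / real p \<le> real p powr s + 1 / L * (ln (real p) / real p)"
        by (simp add: diff_divide_distrib)
    qed
    also have "\<dots> = (\<Sum>p\<in>P. real p powr s) + 1 / L * (\<Sum>p\<in>P. ln (real p) / real p)"
      by (simp only: sum.distrib sum_distrib_left)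
    also have "(\<Sum>p\<in>P. ln (real p) / real p) \<le> 2 * L"
    proof -
      have "(\<Sum>p\<in>P. ln (real p) / real p) \<le> (\<Sum>p\<in>{p::nat. prime p \<and> real p \<le> z}. ln (real p) / real p)"
        by (intro sum_mono2) (auto simp: P_def intro!: divide_nonneg_nonneg dest: prime_ge_1_nat)
      also have "\<dots> \<le> 2 * ln z" using z by (intro sum_ln_over_prime_le) simp
      also have "ln z \<le> \<delta> * L" using \<open>ln z \<le> ln y\<close> ln_y by simp
      also have "\<delta> * L \<le> L" using \<delta> L by simp
      finally show ?thesis by simp
    qed
    finally have "ln (ln z) - ln (1 / \<eta>) - 101 \<le> (\<Sum>p\<in>P. real p powr s) + 2"
      using L by (simp add: mult_left_mono divide_right_mono)
    then have "ln (ln z) + ln \<eta> - 104 \<le> (\<Sum>p\<in>P. real p powr s) - 1"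
      using \<eta> by (simp add: ln_div)
    then have "exp (ln (ln z) + ln \<eta> - 104) \<le> exp ((\<Sum>p\<in>P. real p powr s) - 1)" by simp
    also have "\<dots> \<le> (\<Prod>p\<in>P. 1 + real p powr s)"
      using L fin by (intro exp_sum_le_prod_one_plus_powr) (auto simp: P_def s_def)
    also have "exp (ln (ln z) + ln \<eta> - 104) = exp (-104) * \<eta> * ln z"
    proof -
      have "exp (ln (ln z)) = ln z" using z(2) by simp
      then show ?thesis using \<eta> by (simp add: exp_add exp_diff exp_minus field_simps)
    qed
    finally show ?thesis .
  qed

  have "z ^ k \<ge> x0"
  proof -
    have "L \<le> real k * (\<kappa> * L / u)"
      using mult_right_mono[OF k(1), of "\<kappa> * L / u"] u \<kappa>01 L by simp
    then have "exp L \<le> z ^ k" unfolding z_def by (simp flip: exp_of_nat_mult)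
    then show ?thesis using \<open>x0 > 0\<close> by (simp add: L_def)
  qed
  obtain T where T: "finite T" "\<And>n. n \<in> T \<Longrightarrow> f n = 1 \<and> z ^ k \<le> real n"
    "(\<Sum>p\<in>G. real p powr s) ^ k / fact k * (\<Prod>p\<in>P. 1 + real p powr s) \<le> (\<Sum>n\<in>T. real n powr s)"
    by (rule fold_products_times_prod[OF fin(2,1) _ cm, where z = z and k = k and s = s])
      (use z \<open>P \<inter> G = {}\<close> in \<open>auto simp: P_def G_def\<close>)
  \<comment> \<open>By \<open>G_sum\<close> the \<open>k\<close>-th power is at least 1, so only the
    loss \<open>1 / fact k\<close> remains from the primes in \<open>G\<close>.\<close>
  have "1 / fact k * (exp (-104) * \<eta> * ln z)
      \<le> (\<Sum>p\<in>G. real p powr s) ^ k / fact k * (\<Prod>p\<in>P. 1 + real p powr s)"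
    using P_prod G_sum z \<eta> \<kappa>01 L u by (intro mult_mono divide_right_mono one_le_power) auto
  also have "\<dots> \<le> (\<Sum>n\<in>T. real n powr s)" by (rule T(3))
  also have "\<dots> \<le> 800 * L / real d"
    unfolding s_def L_def using T(2) \<open>z ^ k \<ge> x0\<close>
    by (intro classM_sum_powr_le[OF fM x0 T(1)]) (meson order_trans)
  finally have "1 / fact k * (exp (-104) * \<eta> * (\<kappa> * L / u)) \<le> 800 * L / real d"
    by (simp only: z(3))
  \<comment> \<open>\<open>L\<close> cancels: \<open>ln z\<close> is proportional to
    \<open>L / u\<close>, matching the \<open>L\<close> of the upper bound. This
    \<open>1 / u\<close> and the \<open>\<eta>\<close> of the Euler product together cost at most
    \<open>u * u\<close>.\<close>
  then have "real d * (exp (-104) * \<kappa>) \<le> 800 * fact k * (u * (1 / \<eta>))"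
    using L u d(1) \<eta> by (simp add: field_simps)
  also have "\<dots> \<le> 800 * fact k * (u * u)"
    using \<open>1 / \<eta> \<le> u\<close> u by (intro mult_left_mono) auto
  \<comment> \<open>Since \<open>u \<le> k\<close>, the two factors \<open>u\<close> are absorbed by
    raising \<open>k!\<close> to \<open>(k + 2)!\<close>, which explains the offset 2 in
    \<open>d_ge\<close>.\<close>
  also have "u * u < real (k + 1) * real (k + 2)"
    using \<open>u \<le> u / \<kappa>\<close> k u by (intro mult_strict_mono) auto
  finally have "real d * (exp (-104) * \<kappa>) < 800 * (fact k * (real (k + 1) * real (k + 2)))"
    by simp
  also have "fact k * (real (k + 1) * real (k + 2)) = fact (k + 2)"
    by (simp add: numeral_2_eq_2 algebra_simps)
  finally have "real d * (exp (-104) * \<kappa>) < 800 * fact (k + 2)" .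
  \<comment> \<open>The exponents 104 and 110 add up to the 214 in \<open>C1\<close>; the 800 is the
    constant of \<open>classM_sum_powr_le\<close>.\<close>
  moreover have "exp (-104) * \<kappa> = exp (-214)" unfolding \<kappa> by (simp flip: exp_add)
  ultimately have "exp 214 * (real d * exp (-214)) < exp 214 * (800 * fact (k + 2))"
    by (simp only: mult_less_cancel_left_pos exp_gt_zero)
  moreover have "exp 214 * (real d * exp (-214)) = real d" by (simp add: exp_minus)
  ultimately have "real d < 800 * exp 214 * fact (k + 2)" by simp
  with d_ge show False by (simp add: C1)
qed

theorem theorem1p1:
  shows "\<exists>c3 C1 C2 C3 X0::real. 0 < c3 \<and> c3 < 1 \<and> C1 > 0 \<and> C2 > 0 \<and> C3 > 0 \<and>
    (\<forall>x0 \<ge> X0. \<forall>\<eta> \<delta>::real. 0 < \<eta> \<longrightarrow> \<eta> < 1 \<longrightarrow> 0 < \<delta> \<longrightarrow> \<delta> < 1 \<longrightarrow>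
      (\<forall>(d::nat) f. d \<ge> 1 \<longrightarrow> f \<in> classM1 x0 d \<longrightarrow>
         C1 * inverse (dickman_rho (C2 / (\<eta> * \<delta>))) \<le> real d \<longrightarrow>
         real d \<le> C3 / (\<eta> * \<delta>) * exp ((ln x0) powr c3) \<longrightarrow>
         (\<forall>x::real. x > x0 powr \<delta> \<longrightarrow>
            (\<Sum>p\<in>{p::nat. prime p \<and> real p \<le> x \<and> f p \<noteq> 0 \<and> f p \<noteq> 1}. 1 / real p)
              \<ge> ln (1 / \<eta>)))) \<and>
    (\<forall>c::real. 0 < c \<longrightarrow> c < c3 \<longrightarrow> (\<exists>Q::nat. \<forall>x0 \<ge> X0. \<forall>\<eta> \<delta>::real.
      0 < \<eta> \<longrightarrow> \<eta> < 1 \<longrightarrow> 0 < \<delta> \<longrightarrow> \<delta> < 1 \<longrightarrow>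
      (\<forall>(q::nat) (d::nat) f. prime q \<longrightarrow> q \<ge> Q \<longrightarrow> d dvd (q - 1) \<longrightarrow> d \<ge> 1 \<longrightarrow>
         f \<in> classM1 x0 d \<longrightarrow> primitive_dirichlet_char q f \<longrightarrow>
         \<eta> * \<delta> \<ge> (ln (real q)) powr (- c) \<longrightarrow>
         C1 * inverse (dickman_rho (C2 / (\<eta> * \<delta>))) \<le> real d \<longrightarrow>
         (\<forall>x::real. x > x0 powr \<delta> \<longrightarrow>
            (\<Sum>p\<in>{p::nat. prime p \<and> real p \<le> x \<and> f p \<noteq> 0 \<and> f p \<noteq> 1}. 1 / real p)
              \<ge> ln (1 / \<eta>)))))"
proof -
  let ?C2 = "1 / exp (-110) + 3 :: real"
  note core = classM1_sum_inverse_primes_ge[OF refl refl refl]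
  show ?thesis
  \<comment> \<open>\<open>C1\<close> and \<open>C2\<close> are the constants of
    \<open>classM1_sum_inverse_primes_ge\<close>, and the threshold \<open>exp 1\<close> is its
    hypothesis on \<open>x0\<close>; \<open>c3 = 1/2\<close> and \<open>C3 = 1\<close> meet the
    range conditions.\<close>
  proof (rule exI[of _ "1/2"], rule exI[of _ "800 * exp 214"], rule exI[of _ ?C2], rule exI[of _ 1],
      rule exI[of _ "exp 1"], intro conjI allI impI)
    show "?C2 > 0" by (simp add: add_pos_pos)
  next
    fix c :: real
    show "\<exists>Q::nat. \<forall>x0 \<ge> exp 1. \<forall>\<eta> \<delta>::real.
      0 < \<eta> \<longrightarrow> \<eta> < 1 \<longrightarrow> 0 < \<delta> \<longrightarrow> \<delta> < 1 \<longrightarrow>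
      (\<forall>(q::nat) (d::nat) f. prime q \<longrightarrow> q \<ge> Q \<longrightarrow> d dvd (q - 1) \<longrightarrow> d \<ge> 1 \<longrightarrow>
         f \<in> classM1 x0 d \<longrightarrow> primitive_dirichlet_char q f \<longrightarrow>
         \<eta> * \<delta> \<ge> (ln (real q)) powr (- c) \<longrightarrow>
         800 * exp 214 * inverse (dickman_rho (?C2 / (\<eta> * \<delta>))) \<le> real d \<longrightarrow>
         (\<forall>x::real. x > x0 powr \<delta> \<longrightarrow>
            (\<Sum>p\<in>{p::nat. prime p \<and> real p \<le> x \<and> f p \<noteq> 0 \<and> f p \<noteq> 1}. 1 / real p)
              \<ge> ln (1 / \<eta>)))"
      by (intro exI[of _ 0] allI impI) (rule core)
  qed (simp, simp, simp, simp, rule core)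
qed

end
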